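(* Let $p,q\ge0$ with $p+q=1$ and $p<q$. Let $(\zeta_t)_{t\ge0}$ be the zero range process on $\mathbb{N}_+$ with an infinite well of particles at the site $0$ and generator $\mathcal{L}_{\mathrm{ZR}}$ (given in the context), and let $X_t=\sum_{x\ge1}\zeta_t(x)$. If $\zeta(x)=0$ for all $x\ge1$ and $\mathbb{P}_\zeta$ denotes the probability measure under which $\zeta_0=\zeta$, then $$\mathbb{P}_\zeta(X_t\in\cdot)\to\mu\left(\sum_{x\ge1}\zeta(x)\in\cdot\right)\qquad\text{weakly as } t\to\infty,$$ where $\mu$ is the product measure on $\mathbb{N}^{\mathbb{N}_+}$ with marginals $$\mu(\eta:\eta(x)=k)=(p/q)^{kx}\left(1-(p/q)^x\right),\qquad k\ge0,\ x\in\mathbb{N}_+.$$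
   Context: $\mathbb{N}=\{0,1,2,\dots\}$ and $\mathbb{N}_+=\{1,2,\dots\}$. The zero range process takes values in $\Omega=\{\eta\in\mathbb{N}^{\mathbb{N}_+}:\sum_{x\ge1}\eta(x)<\infty\}$ and has generator, acting on local functions $f$, $$\mathcal{L}_{\mathrm{ZR}}f(\zeta)=p[f(\zeta^{0,1})-f(\zeta)]+\sum_{x\ge1}1_{\{\zeta(x)\ge1\}}\left\{p[f(\zeta^{x,x+1})-f(\zeta)]+q[f(\zeta^{x,x-1})-f(\zeta)]\right\}.$$ Here, for $x,y\ge1$, $\zeta^{x,y}$ is $\zeta$ with one particle moved from $x$ to $y$ (so $\zeta^{x,y}(x)=\zeta(x)-1$, $\zeta^{x,y}(y)=\zeta(y)+1$, other values unchanged); $\zeta^{0,1}$ is $\zeta$ with one particle added at site $1$; and $\zeta^{1,0}$ is $\zeta$ with one particle removed from site $1$. (The quantity $X_t$ is the position at time $t$ of the tagged right-most particle, initially at $0$, of the nearest-neighbor asymmetric simple exclusion process on $\mathbb{Z}$ with jump rates $p$ to the right and $q$ to the left, started with every site $x\le0$ occupied and every site $x>0$ vacant; $\zeta_t(x)$, $x\ge1$, are the numbers of vacant sites between consecutive particles.) *)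

theory Defs
  imports "HOL-Probability.Probability"
begin

section \<open>Configurations\<close>

text \<open>
  The sites \<open>x \<ge> 1\<close> form the index set \<open>{1..}\<close>, and \<open>\<nat>\<close>-valued families indexed by them are
  the extensional functions \<open>{1..} \<rightarrow>\<^sub>E UNIV\<close>, i.e. the underlying space of the product measure
  \<open>\<Pi>\<^sub>M x\<in>{1..}. \<dots>\<close>. For such families, finiteness of the sum is finiteness of the support.
\<close>

type_synonym config = "nat \<Rightarrow> nat"

definition configs :: "config set" where
  "configs = {\<eta> \<in> {1..} \<rightarrow>\<^sub>E UNIV. finite {x \<in> {1..}. \<eta> x \<noteq> 0}}"

text \<open>
  As usual for \<open>infsum\<close>, the value is 0 where the series diverges; under the product measure
  below this concerns a null set only.
\<close>

definition num_particles :: "config \<Rightarrow> real" where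
  "num_particles \<eta> = (\<Sum>\<^sub>\<infinity>x\<in>{1..}. real (\<eta> x))"

text \<open>
  \<open>move x y \<zeta>\<close> is \<open>\<zeta>\<^sup>x\<^sup>,\<^sup>y\<close> for \<open>x \<noteq> y\<close>. The site 0 is the infinite well: a particle
  coming from it is created, a particle going to it is destroyed.
\<close>

definition remove_at :: "nat \<Rightarrow> config \<Rightarrow> config" where
  "remove_at x \<zeta> = (if x = 0 then \<zeta> else \<zeta>(x := \<zeta> x - 1))"

definition add_at :: "nat \<Rightarrow> config \<Rightarrow> config" where
  "add_at y \<zeta> = (if y = 0 then \<zeta> else \<zeta>(y := \<zeta> y + 1))"

definition move :: "nat \<Rightarrow> nat \<Rightarrow> config \<Rightarrow> config" where
  "move x y \<zeta> = add_at y (remove_at x \<zeta>)"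


section \<open>The generator\<close>

definition gen_ZR :: "real \<Rightarrow> real \<Rightarrow> (config \<Rightarrow> real) \<Rightarrow> config \<Rightarrow> real" where
  "gen_ZR p q f \<zeta> =
     p * (f (move 0 1 \<zeta>) - f \<zeta>) +
     (\<Sum>\<^sub>\<infinity>x\<in>{1..}. of_bool (\<zeta> x \<ge> 1) *
        (p * (f (move x (x + 1) \<zeta>) - f \<zeta>) + q * (f (move x (x - 1) \<zeta>) - f \<zeta>)))"

definition local_fun :: "(config \<Rightarrow> real) \<Rightarrow> bool" where
  "local_fun f \<longleftrightarrow>
     (\<exists>A. finite A \<and> A \<subseteq> {1..} \<and>
        (\<forall>\<eta>\<in>configs. \<forall>\<xi>\<in>configs. (\<forall>x\<in>A. \<eta> x = \<xi> x) \<longrightarrow> f \<eta> = f \<xi>))"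


section \<open>Markov processes and their generators\<close>

definition natural_filtration :: "'s measure \<Rightarrow> (real \<Rightarrow> 's \<Rightarrow> 'e) \<Rightarrow> 'e set \<Rightarrow> real \<Rightarrow> 's measure" where
  "natural_filtration N Z E s =
     sigma (space N) (\<Union>u\<in>{0..s}. {Z u -` A \<inter> space N | A. A \<subseteq> E})"

text \<open>
  A time-homogeneous Markov process on a countable state space \<open>E\<close> with the discrete
  \<open>\<sigma>\<close>-algebra, given by a family of laws \<open>P \<eta>\<close> (\<open>\<eta> \<in> E\<close> the starting point) on one measurable
  space \<open>N\<close>. No path regularity is imposed. For \<open>E = configs\<close>, which is countable, the
  discrete \<open>\<sigma>\<close>-algebra is the trace of the product \<open>\<sigma>\<close>-algebra.
\<close>

locale markov_process =
  fixes E :: "'e set" and N :: "'s measure" and P :: "'e \<Rightarrow> 's measure"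
    and Z :: "real \<Rightarrow> 's \<Rightarrow> 'e"
  assumes countable_states: "countable E"
    and prob: "\<And>\<eta>. \<eta> \<in> E \<Longrightarrow> prob_space (P \<eta>)"
    and sets_law: "\<And>\<eta>. \<eta> \<in> E \<Longrightarrow> sets (P \<eta>) = sets N"
    and measurable_state: "\<And>t. 0 \<le> t \<Longrightarrow> Z t \<in> N \<rightarrow>\<^sub>M count_space E"
    and start: "\<And>\<eta>. \<eta> \<in> E \<Longrightarrow> AE \<omega> in P \<eta>. Z 0 \<omega> = \<eta>"
    and markov: "\<And>\<eta> s t f. \<lbrakk>\<eta> \<in> E; 0 \<le> s; 0 \<le> t; bounded (f ` E)\<rbrakk> \<Longrightarrow>
          AE \<omega> in P \<eta>.
            real_cond_exp (P \<eta>) (natural_filtration N Z E s) (\<lambda>\<omega>'. f (Z (s + t) \<omega>')) \<omega>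
            = (\<integral>\<omega>'. f (Z t \<omega>') \<partial>P (Z s \<omega>))"

definition semigroup_of ::
  "('e \<Rightarrow> 's measure) \<Rightarrow> (real \<Rightarrow> 's \<Rightarrow> 'e) \<Rightarrow> real \<Rightarrow> ('e \<Rightarrow> real) \<Rightarrow> 'e \<Rightarrow> real" where
  "semigroup_of P Z t f \<eta> = (\<integral>\<omega>. f (Z t \<omega>) \<partial>P \<eta>)"

text \<open>
  The semigroup acts on the bounded functions on \<open>configs\<close>, and its generator is the derivative
  at time 0 in supremum norm. It is required to be \<open>gen_ZR p q\<close> on the bounded local functions;
  there \<open>gen_ZR p q f\<close> is again bounded and local.
\<close>

locale zero_range_process = markov_process configs N P Z
  for p q :: real and N :: "'s measure" and P :: "config \<Rightarrow> 's measure"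
    and Z :: "real \<Rightarrow> 's \<Rightarrow> config" +
  assumes generator: "\<And>f. \<lbrakk>local_fun f; bounded (f ` configs)\<rbrakk> \<Longrightarrow>
    uniform_limit configs (\<lambda>t \<eta>. (semigroup_of P Z t f \<eta> - f \<eta>) / t) (gen_ZR p q f) (at_right 0)"


section \<open>The limiting measure\<close>

definition mu_ZR :: "real \<Rightarrow> real \<Rightarrow> config measure" where
  "mu_ZR p q = (\<Pi>\<^sub>M x\<in>{1..}.
     density (count_space UNIV) (\<lambda>k. ennreal ((p / q) ^ (k * x) * (1 - (p / q) ^ x))))"

end

theory Submission
  imports Defs
begin

text \<open>
  The measure \<open>\<mu>\<close> is carried by the countable set of finite configurations and satisfies detailed
  balance for the zero range dynamics, so the generator is symmetric on local functions. A local
  function has a convergent exponential series \<open>\<Sum>k. t\<^sup>k L\<^sup>k f / k!\<close> for \<open>t \<le> 1/4\<close>, so the semigroup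
  \<open>S\<close> is symmetric on \<open>L\<^sup>2(\<mu>)\<close>, first for small and then for all times. For a bounded function \<open>f\<close>
  the function \<open>t \<mapsto> \<parallel>S t f\<parallel>\<^sup>2\<close> is then decreasing, and symmetry makes \<open>S t f\<close> Cauchy in \<open>L\<^sup>2(\<mu>)\<close>, hence
  pointwise convergent, to a bounded harmonic function. The Dirichlet form of a harmonic function
  vanishes, hence for \<open>p > 0\<close> it is constant, with value \<open>\<integral>f d\<mu>\<close>. This gives total variation convergence
  of the law of the configuration started from the vacuum. For \<open>p = 0\<close> the measure \<open>\<mu>\<close> is the point
  mass at the vacuum, and its invariance suffices.
\<close>

section \<open>Markov semigroups with a reversible measure\<close>

text \<open>The bound is an explicit constant, so that dominated convergence and the Taylor
  estimates can use one \<open>B\<close> for a whole sequence of functions. It concerns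
  \<open>E\<close> only, since values off the state space are arbitrary.\<close>

definition abs_le_on :: "'e set \<Rightarrow> ('e \<Rightarrow> real) \<Rightarrow> real \<Rightarrow> bool" where
  "abs_le_on E f B \<longleftrightarrow> (\<forall>x\<in>E. \<bar>f x\<bar> \<le> B)"

lemma abs_le_onI: "(\<And>x. x \<in> E \<Longrightarrow> \<bar>f x\<bar> \<le> B) \<Longrightarrow> abs_le_on E f B"
  by (simp add: abs_le_on_def)

lemma abs_le_onD: "abs_le_on E f B \<Longrightarrow> x \<in> E \<Longrightarrow> \<bar>f x\<bar> \<le> B"
  by (simp add: abs_le_on_def)

lemma abs_le_on_nonneg: "abs_le_on E f B \<Longrightarrow> x \<in> E \<Longrightarrow> 0 \<le> B"
  using abs_le_onD by fastforce

lemma abs_le_on_diff: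
  "abs_le_on E f B \<Longrightarrow> abs_le_on E g C \<Longrightarrow> abs_le_on E (\<lambda>x. f x - g x) (B + C)"
  unfolding abs_le_on_def by fastforce

lemma abs_le_on_mult:
  assumes "abs_le_on E f B" "abs_le_on E g C"
  shows "abs_le_on E (\<lambda>x. f x * g x) (B * C)"
  using assms abs_le_on_nonneg[OF assms(1)] unfolding abs_le_on_def
  by (auto simp: abs_mult intro!: mult_mono)

lemma abs_le_on_cmult:
  "abs_le_on E f B \<Longrightarrow> abs_le_on E (\<lambda>x. c * f x) (\<bar>c\<bar> * B)"
  unfolding abs_le_on_def by (auto simp: abs_mult intro!: mult_left_mono)

lemma integrable_pmf_abs_le_on:
  assumes "set_pmf M \<subseteq> E" "abs_le_on E f B"
  shows "integrable (measure_pmf M) f"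
  using assms
  by (intro measure_pmf.integrable_const_bound[where B = B]) (auto simp: AE_measure_pmf_iff abs_le_on_def)

lemma integral_pmf_cong:
  assumes "\<And>x. x \<in> set_pmf M \<Longrightarrow> f x = g x"
  shows "(\<integral>x. f x \<partial>measure_pmf M) = (\<integral>x. (g x :: real) \<partial>measure_pmf M)"
  using assms by (intro integral_cong_AE) (auto simp: AE_measure_pmf_iff)

lemma integral_pmf_tendsto:
  fixes f :: "nat \<Rightarrow> 'e \<Rightarrow> real"
  assumes "set_pmf M \<subseteq> E" "\<And>n. abs_le_on E (f n) B"
    and "\<And>x. x \<in> set_pmf M \<Longrightarrow> (\<lambda>n. f n x) \<longlonglongrightarrow> g x"
  shows "(\<lambda>n. \<integral>x. f n x \<partial>measure_pmf M) \<longlonglongrightarrow> (\<integral>x. g x \<partial>measure_pmf M)"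
  using assms
  by (intro integral_dominated_convergence[where w = "\<lambda>_. B"])
     (auto simp: AE_measure_pmf_iff abs_le_on_def)

text \<open>A single atom contributes at most the whole integral. This turns estimates in
  \<open>L^2\<close> into estimates at each point of the support.\<close>

lemma pmf_mult_le_integral:
  assumes "integrable (measure_pmf M) f" "\<And>y. y \<in> set_pmf M \<Longrightarrow> 0 \<le> f y" "x \<in> set_pmf M"
  shows "pmf M x * f x \<le> (\<integral>y. f y \<partial>measure_pmf M)"
proof -
  have "pmf M x * f x = (\<integral>y. f x * indicator {x} y \<partial>measure_pmf M)"
    by (simp add: measure_pmf_single)
  also have "\<dots> \<le> (\<integral>y. f y \<partial>measure_pmf M)"
  proof (rule integral_mono_AE)
    show "integrable (measure_pmf M) (\<lambda>y. f x * indicator {x} y)"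
      by (rule integrable_pmf_abs_le_on[where E = UNIV and B = "\<bar>f x\<bar>"])
         (auto simp: abs_le_on_def indicator_def)
  qed (use assms in \<open>auto simp: AE_measure_pmf_iff indicator_def\<close>)
  finally show ?thesis .
qed

section \<open>Elementary properties of the semigroup of a Markov process\<close>

context markov_process
begin

abbreviation S :: "real \<Rightarrow> ('e \<Rightarrow> real) \<Rightarrow> 'e \<Rightarrow> real" where
  "S \<equiv> semigroup_of P Z"

lemma measurable_obs:
  assumes "0 \<le> t" "\<eta> \<in> E"
  shows "(\<lambda>\<omega>. f (Z t \<omega>) :: real) \<in> borel_measurable (P \<eta>)"
proof -
  have "(\<lambda>\<omega>. f (Z t \<omega>)) \<in> borel_measurable N"
    by (rule measurable_compose[OF measurable_state[OF assms(1)]]) simp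
  then show ?thesis
    using sets_law[OF assms(2)] measurable_cong_sets by blast
qed

lemma state_in:
  assumes "0 \<le> t" "\<eta> \<in> E" "\<omega> \<in> space (P \<eta>)"
  shows "Z t \<omega> \<in> E"
  using measurable_space[OF measurable_state[OF assms(1)]] assms(3)
    sets_eq_imp_space_eq[OF sets_law[OF assms(2)]] by auto

lemma integrable_obs:
  assumes "0 \<le> t" "\<eta> \<in> E" "abs_le_on E f B"
  shows "integrable (P \<eta>) (\<lambda>\<omega>. f (Z t \<omega>) :: real)"
proof -
  interpret prob_space "P \<eta>" by (rule prob[OF assms(2)])
  show ?thesis
    using measurable_obs[OF assms(1,2)] state_in[OF assms(1,2)] abs_le_onD[OF assms(3)]
    by (intro integrable_const_bound[where B = B]) auto
qed

lemma S_diff: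
  assumes "0 \<le> t" "\<eta> \<in> E" "abs_le_on E f B" "abs_le_on E g C"
  shows "S t (\<lambda>\<xi>. f \<xi> - g \<xi>) \<eta> = S t f \<eta> - S t g \<eta>"
  unfolding semigroup_of_def
  using integrable_obs[OF assms(1-3)] integrable_obs[OF assms(1,2,4)]
  by (rule Bochner_Integration.integral_diff)

lemma S_cmult: "S t (\<lambda>\<xi>. c * f \<xi>) \<eta> = c * S t f \<eta>"
  unfolding semigroup_of_def by simp

lemma S_const:
  assumes "0 \<le> t" "\<eta> \<in> E"
  shows "S t (\<lambda>\<xi>. c) \<eta> = c"
proof -
  interpret prob_space "P \<eta>" by (rule prob[OF assms(2)])
  show ?thesis unfolding semigroup_of_def by (simp add: prob_space)
qed

lemma S_abs_le:
  assumes "0 \<le> t" "\<eta> \<in> E" "abs_le_on E f B"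
  shows "\<bar>S t f \<eta>\<bar> \<le> B"
proof -
  interpret prob_space "P \<eta>" by (rule prob[OF assms(2)])
  have "\<bar>S t f \<eta>\<bar> \<le> (\<integral>\<omega>. \<bar>f (Z t \<omega>)\<bar> \<partial>P \<eta>)"
    unfolding semigroup_of_def by (rule integral_abs_bound)
  also have "\<dots> \<le> (\<integral>\<omega>. B \<partial>P \<eta>)"
    using integrable_abs[OF integrable_obs[OF assms]]
    by (rule integral_mono) (auto intro: state_in[OF assms(1,2)] abs_le_onD[OF assms(3)])
  finally show ?thesis by (simp add: prob_space)
qed

lemma abs_le_on_S: "0 \<le> t \<Longrightarrow> abs_le_on E f B \<Longrightarrow> abs_le_on E (S t f) B"
  using S_abs_le by (intro abs_le_onI) blast

lemma S_tendsto:
  assumes "0 \<le> t" "\<eta> \<in> E" "\<And>n. abs_le_on E (f n) B"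
    and "\<And>\<xi>. \<xi> \<in> E \<Longrightarrow> (\<lambda>n. f n \<xi>) \<longlonglongrightarrow> g \<xi>"
  shows "(\<lambda>n. S t (f n) \<eta>) \<longlonglongrightarrow> S t g \<eta>"
proof -
  interpret prob_space "P \<eta>" by (rule prob[OF assms(2)])
  show ?thesis
    unfolding semigroup_of_def
    using assms(4) measurable_obs[OF assms(1,2)] state_in[OF assms(1,2)] abs_le_onD[OF assms(3)]
    by (intro integral_dominated_convergence[where w = "\<lambda>_. B"]) auto
qed

lemma S_zero:
  assumes "\<eta> \<in> E"
  shows "S 0 f \<eta> = f \<eta>"
proof -
  interpret prob_space "P \<eta>" by (rule prob[OF assms])
  have "S 0 f \<eta> = (\<integral>\<omega>. f \<eta> \<partial>P \<eta>)"
    unfolding semigroup_of_def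
    using start[OF assms] measurable_obs[OF _ assms] by (intro integral_cong_AE) auto
  then show ?thesis by (simp add: prob_space)
qed

text \<open>Tower property: conditioning on the natural filtration at time \<open>s\<close> leaves
  the expectation unchanged, and the Markov property identifies the conditional expectation with
  \<open>S t f (Z s)\<close>.\<close>

lemma S_semigroup:
  assumes "0 \<le> s" "0 \<le> t" "\<eta> \<in> E" "abs_le_on E f B"
  shows "S (s + t) f \<eta> = S s (S t f) \<eta>"
proof -
  interpret prob_space "P \<eta>" by (rule prob[OF assms(3)])
  let ?F = "natural_filtration N Z E s"
  have sp: "space (P \<eta>) = space N"
    using sets_eq_imp_space_eq[OF sets_law[OF assms(3)]] .
  \<comment> \<open>Every subset of \<open>E\<close> is measurable in \<open>count_space E\<close>,
    so each generator of the filtration is an event of \<open>N\<close>.\<close>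
  have gen: "(\<Union>u\<in>{0..s}. {Z u -` A \<inter> space N |A. A \<subseteq> E}) \<subseteq> sets N"
    using measurable_sets[OF measurable_state] by fastforce
  have "subalgebra (P \<eta>) ?F"
    unfolding subalgebra_def natural_filtration_def
    using gen sets_law[OF assms(3)] sp sets.space_closed[of N]
    by (subst sets_measure_of) (auto intro!: sets.sigma_sets_subset simp: space_measure_of_conv)
  then interpret finite_measure_subalgebra "P \<eta>" ?F
    by unfold_locales
  have bdd: "bounded (f ` E)"
    using assms(4) by (auto simp: bounded_iff abs_le_on_def)
  have "S (s + t) f \<eta> = (\<integral>\<omega>. real_cond_exp (P \<eta>) ?F (\<lambda>\<omega>'. f (Z (s + t) \<omega>')) \<omega> \<partial>P \<eta>)"
    unfolding semigroup_of_def
    using integrable_obs[of "s + t" \<eta> f B] assms by (subst real_cond_exp_int(2)) auto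
  also have "\<dots> = (\<integral>\<omega>. S t f (Z s \<omega>) \<partial>P \<eta>)"
    using markov[OF assms(3,1,2) bdd] measurable_obs[OF assms(1,3)]
    by (intro integral_cong_AE) (auto simp: semigroup_of_def)
  finally show ?thesis by (simp add: semigroup_of_def)
qed

text \<open>Jensen's inequality for the square, read off from the nonnegativity of a
  variance.\<close>

lemma S_square_le:
  assumes "0 \<le> t" "\<eta> \<in> E" "abs_le_on E f B"
  shows "(S t f \<eta>)\<^sup>2 \<le> S t (\<lambda>\<xi>. (f \<xi>)\<^sup>2) \<eta>"
proof -
  interpret prob_space "P \<eta>" by (rule prob[OF assms(2)])
  have i: "integrable (P \<eta>) (\<lambda>\<omega>. (f (Z t \<omega>))\<^sup>2)"
    using integrable_obs[OF assms(1,2) abs_le_on_mult[OF assms(3,3)]]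
    by (simp add: power2_eq_square)
  have "0 \<le> variance (\<lambda>\<omega>. f (Z t \<omega>))"
    by (rule variance_positive)
  also have "\<dots> = S t (\<lambda>\<xi>. (f \<xi>)\<^sup>2) \<eta> - (S t f \<eta>)\<^sup>2"
    using variance_eq[OF integrable_obs[OF assms] i] by (simp add: semigroup_of_def)
  finally show ?thesis by simp
qed

end

section \<open>Long-time convergence of a symmetric semigroup\<close>

locale reversible_process = markov_process E N P Z
  for E :: "'e set" and N :: "'s measure" and P :: "'e \<Rightarrow> 's measure"
    and Z :: "real \<Rightarrow> 's \<Rightarrow> 'e" +
  fixes M :: "'e pmf"
  assumes supp: "set_pmf M \<subseteq> E"
    and symmetric: "\<And>t f g B C. 0 \<le> t \<Longrightarrow> abs_le_on E f B \<Longrightarrow> abs_le_on E g C \<Longrightarrow>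
      (\<integral>x. g x * S t f x \<partial>measure_pmf M) = (\<integral>x. f x * S t g x \<partial>measure_pmf M)"
begin

lemma integrable_M: "abs_le_on E f B \<Longrightarrow> integrable (measure_pmf M) f"
  by (rule integrable_pmf_abs_le_on[OF supp])

text \<open>Symmetry tested against the constant 1, which the semigroup fixes.\<close>

lemma S_invariant:
  assumes "0 \<le> t" "abs_le_on E f B"
  shows "(\<integral>x. S t f x \<partial>measure_pmf M) = (\<integral>x. f x \<partial>measure_pmf M)"
proof -
  have "(\<integral>x. f x * S t (\<lambda>_. 1) x \<partial>measure_pmf M) = (\<integral>x. f x \<partial>measure_pmf M)"
    using supp S_const[OF assms(1)] by (intro integral_pmf_cong) auto
  then show ?thesis
    using symmetric[OF assms, of "\<lambda>_. 1" 1] by (simp add: abs_le_on_def)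
qed

definition autocorr :: "('e \<Rightarrow> real) \<Rightarrow> real \<Rightarrow> real" where
  "autocorr f t = (\<integral>x. f x * S t f x \<partial>measure_pmf M)"

text \<open>Symmetry moves \<open>S s\<close> to the other factor and the semigroup law merges the
  two times: inner products along the orbit of \<open>f\<close> depend on the sum of the times
  only.\<close>

lemma integral_S_mult_S:
  assumes "0 \<le> s" "0 \<le> t" "abs_le_on E f B"
  shows "(\<integral>x. S s f x * S t f x \<partial>measure_pmf M) = autocorr f (s + t)"
proof -
  have "(\<integral>x. S s f x * S t f x \<partial>measure_pmf M) = (\<integral>x. f x * S t (S s f) x \<partial>measure_pmf M)"
    by (rule symmetric[OF assms(2,3) abs_le_on_S[OF assms(1,3)]])
  also have "\<dots> = autocorr f (s + t)"
    unfolding autocorr_def using supp S_semigroup[OF assms(2,1) _ assms(3)]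
    by (intro integral_pmf_cong) (auto simp: add.commute)
  finally show ?thesis .
qed

lemma autocorr_nonneg:
  assumes "0 \<le> t" "abs_le_on E f B"
  shows "0 \<le> autocorr f (2 * t)"
proof -
  have "0 \<le> (\<integral>x. S t f x * S t f x \<partial>measure_pmf M)" by simp
  then show ?thesis using integral_S_mult_S[OF assms(1,1,2)] by simp
qed

text \<open>\<open>autocorr f (2 * t)\<close> is the squared norm of \<open>S t f\<close> in
  \<open>L^2(M)\<close>. Jensen's inequality and invariance make the semigroup a contraction
  there.\<close>

lemma autocorr_antimono:
  assumes "0 \<le> s" "s \<le> t" "abs_le_on E f B"
  shows "autocorr f (2 * t) \<le> autocorr f (2 * s)"
proof -
  let ?h = "t - s" and ?u = "S s f"
  have u: "abs_le_on E ?u B" and h: "0 \<le> ?h"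
    using abs_le_on_S[OF assms(1,3)] assms(2) by auto
  have u2: "abs_le_on E (\<lambda>x. (?u x)\<^sup>2) (B * B)"
    using abs_le_on_mult[OF u u] by (simp add: power2_eq_square)
  have hu: "abs_le_on E (\<lambda>x. (S ?h ?u x)\<^sup>2) (B * B)"
    using abs_le_on_mult[OF abs_le_on_S[OF h u] abs_le_on_S[OF h u]] by (simp add: power2_eq_square)
  have "autocorr f (2 * t) = (\<integral>x. (S t f x)\<^sup>2 \<partial>measure_pmf M)"
    using integral_S_mult_S[of t t f B] assms by (simp add: power2_eq_square)
  also have "\<dots> = (\<integral>x. (S ?h ?u x)\<^sup>2 \<partial>measure_pmf M)"
    using supp S_semigroup[OF h assms(1) _ assms(3)] by (intro integral_pmf_cong) auto
  also have "\<dots> \<le> (\<integral>x. S ?h (\<lambda>y. (?u y)\<^sup>2) x \<partial>measure_pmf M)"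
    using supp S_square_le[OF h _ u]
    by (intro integral_mono_AE integrable_M[OF hu] integrable_M[OF abs_le_on_S[OF h u2]])
       (auto simp: AE_measure_pmf_iff)
  also have "\<dots> = autocorr f (2 * s)"
    using S_invariant[OF h u2] integral_S_mult_S[OF assms(1,1,3)] by (simp add: power2_eq_square)
  finally show ?thesis .
qed

text \<open>In \<open>L\<^sup>2(M)\<close> the squared distance of \<open>S s f\<close> and \<open>S t f\<close> is
  \<open>a (2 * s) + a (2 * t) - 2 * a (s + t)\<close> with the monotone function \<open>a = autocorr f\<close>.\<close>

lemma S_Cauchy:
  assumes f: "abs_le_on E f B" and x: "x \<in> set_pmf M" and "0 < e"
  obtains T where "0 \<le> T" "\<And>s t. T \<le> s \<Longrightarrow> T \<le> t \<Longrightarrow> \<bar>S s f x - S t f x\<bar> < e"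
proof -
  let ?a = "\<lambda>t. autocorr f (2 * t)"
  define L where "L = (INF t\<in>{0..}. ?a t)"
  \<comment> \<open>Chosen so that the bound \<open>2 * d\<close> on the squared distance becomes
    \<open>e\<^sup>2\<close> after division by the mass of \<open>x\<close>.\<close>
  define d where "d = pmf M x * e\<^sup>2 / 2"
  have px: "0 < pmf M x" using x by (simp add: pmf_positive)
  have "0 < d" using px \<open>0 < e\<close> by (simp add: d_def)
  have bdd: "bdd_below (?a ` {0..})"
    using autocorr_nonneg[OF _ f] by (auto intro!: bdd_belowI)
  obtain T where T: "0 \<le> T" "?a T < L + d"
    using cInf_lessD[of "?a ` {0..}" "L + d"] \<open>0 < d\<close> by (auto simp: L_def)
  have a: "L \<le> ?a t" "?a t < L + d" if "T \<le> t" for t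
    using that T autocorr_antimono[OF T(1) that f] cINF_lower[OF bdd, of t] by (auto simp: L_def)
  show thesis
  proof (rule that[OF T(1)])
    fix s t assume st: "T \<le> s" "T \<le> t"
    let ?F = "\<lambda>y. (S s f y - S t f y)\<^sup>2"
    have pos: "0 \<le> s" "0 \<le> t" using st T by auto
    note bs = abs_le_on_S[OF pos(1) f] and bt = abs_le_on_S[OF pos(2) f]
    have iF: "integrable (measure_pmf M) ?F"
      using integrable_M[OF abs_le_on_mult[OF abs_le_on_diff[OF bs bt] abs_le_on_diff[OF bs bt]]]
      by (simp add: power2_eq_square)
    have "pmf M x * ?F x \<le> (\<integral>y. ?F y \<partial>measure_pmf M)"
      by (rule pmf_mult_le_integral[OF iF _ x]) simp
    also have "\<dots> = (\<integral>y. S s f y * S s f y + S t f y * S t f y - 2 * (S s f y * S t f y) \<partial>measure_pmf M)"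
      by (simp add: power2_eq_square algebra_simps)
    also have "\<dots> = ?a s + ?a t - 2 * autocorr f (s + t)"
      using integrable_M[OF abs_le_on_mult[OF bs bs]] integrable_M[OF abs_le_on_mult[OF bt bt]]
        integrable_M[OF abs_le_on_mult[OF bs bt]] pos
      by (simp add: integral_S_mult_S[OF _ _ f] flip: mult_2)
    also have "\<dots> < 2 * d"
    proof -
      \<comment> \<open>Written as twice the midpoint of \<open>s\<close> and \<open>t\<close>, the
        time \<open>s + t\<close> falls under the lower bound \<open>L\<close>; the squared distance
        is then below \<open>2 * (L + d) - 2 * L\<close>.\<close>
      have "L \<le> autocorr f (2 * ((s + t) / 2))" using st by (intro a(1)) simp
      also have "2 * ((s + t) / 2) = s + t" by simp
      finally show ?thesis using a(2)[OF st(1)] a(2)[OF st(2)] by simp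
    qed
    finally have "?F x < e\<^sup>2"
      using px by (simp add: d_def)
    show "\<bar>S s f x - S t f x\<bar> < e"
      by (rule power2_less_imp_less) (use \<open>?F x < e\<^sup>2\<close> \<open>0 < e\<close> in simp_all)
  qed
qed

text \<open>Since \<open>M\<close> charges every state, the Cauchy estimate applies everywhere.
  Dominated convergence under the transition laws makes the limit harmonic; under \<open>M\<close>,
  together with invariance, it preserves the integral.\<close>

theorem S_converges:
  assumes full: "set_pmf M = E" and f: "abs_le_on E f B"
  obtains g where "abs_le_on E g B" "\<And>x. x \<in> E \<Longrightarrow> ((\<lambda>t. S t f x) \<longlongrightarrow> g x) at_top"
    "\<And>s x. 0 \<le> s \<Longrightarrow> x \<in> E \<Longrightarrow> S s g x = g x"
    "(\<integral>x. g x \<partial>measure_pmf M) = (\<integral>x. f x \<partial>measure_pmf M)"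
proof -
  \<comment> \<open>The limit is taken along integer times, where dominated convergence for
    sequences applies; the Cauchy estimate extends it to real times.\<close>
  define g where "g x = lim (\<lambda>n. S (real n) f x)" for x
  have seq: "(\<lambda>n. S (real n) f x) \<longlonglongrightarrow> g x" if x: "x \<in> E" for x
  proof -
    have "Cauchy (\<lambda>n. S (real n) f x)"
    proof (rule metric_CauchyI)
      fix e :: real assume "0 < e"
      then obtain T where T: "\<And>s t. T \<le> s \<Longrightarrow> T \<le> t \<Longrightarrow> \<bar>S s f x - S t f x\<bar> < e"
        using S_Cauchy[OF f] x full by blast
      obtain k :: nat where "T \<le> real k" using real_arch_simple by blast
      then show "\<exists>k. \<forall>m\<ge>k. \<forall>n\<ge>k. dist (S (real m) f x) (S (real n) f x) < e"
        using T by (intro exI[of _ k]) (auto simp: dist_real_def)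
    qed
    then show ?thesis
      by (simp add: Cauchy_convergent_iff convergent_LIMSEQ_iff g_def)
  qed
  have bn: "abs_le_on E (S (real n) f) B" for n
    by (rule abs_le_on_S[OF _ f]) simp
  have lim: "((\<lambda>t. S t f x) \<longlongrightarrow> g x) at_top" if x: "x \<in> E" for x
  proof (rule tendstoI)
    fix e :: real assume "0 < e"
    then obtain T where T: "\<And>s t. T \<le> s \<Longrightarrow> T \<le> t \<Longrightarrow> \<bar>S s f x - S t f x\<bar> < e / 2"
      using S_Cauchy[OF f, of x "e / 2"] x full half_gt_zero by metis
    have "dist (S t f x) (g x) < e" if "T \<le> t" for t
    proof -
      have "(\<lambda>n. \<bar>S t f x - S (real n) f x\<bar>) \<longlonglongrightarrow> \<bar>S t f x - g x\<bar>"
        by (intro tendsto_intros seq x)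
      moreover have "\<forall>\<^sub>F n in sequentially. \<bar>S t f x - S (real n) f x\<bar> \<le> e / 2"
        using eventually_ge_at_top[of "nat \<lceil>T\<rceil>"]
        by eventually_elim (use T that in \<open>auto intro!: less_imp_le\<close>)
      ultimately have "\<bar>S t f x - g x\<bar> \<le> e / 2"
        by (intro tendsto_upperbound[where F = sequentially]) auto
      then show ?thesis using \<open>0 < e\<close> by (simp add: dist_real_def)
    qed
    then show "\<forall>\<^sub>F t in at_top. dist (S t f x) (g x) < e"
      using eventually_at_top_linorder by blast
  qed
  have gB: "abs_le_on E g B"
  proof (rule abs_le_onI)
    fix x assume x: "x \<in> E"
    have "(\<lambda>n. \<bar>S (real n) f x\<bar>) \<longlonglongrightarrow> \<bar>g x\<bar>" by (intro tendsto_intros seq x)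
    then show "\<bar>g x\<bar> \<le> B"
      by (rule tendsto_upperbound) (use abs_le_onD[OF bn x] in auto)
  qed
  have harm: "S s g x = g x" if s: "0 \<le> s" and x: "x \<in> E" for s x
  proof -
    have "(\<lambda>n. S s (S (real n) f) x) \<longlonglongrightarrow> S s g x"
      by (rule S_tendsto[OF s x bn seq])
    moreover have "S s (S (real n) f) x = S (s + real n) f x" for n
      by (rule S_semigroup[OF s _ x f, symmetric]) simp
    moreover have "(\<lambda>n. S (s + real n) f x) \<longlonglongrightarrow> g x"
      by (rule filterlim_compose[OF lim[OF x]])
         (rule filterlim_tendsto_add_at_top[OF tendsto_const filterlim_real_sequentially])
    ultimately show ?thesis
      using LIMSEQ_unique by (metis (no_types, lifting) ext)
  qed
  have "(\<lambda>n. \<integral>x. S (real n) f x \<partial>measure_pmf M) \<longlonglongrightarrow> (\<integral>x. g x \<partial>measure_pmf M)"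
    by (rule integral_pmf_tendsto[OF supp bn]) (use seq supp in auto)
  then have "(\<integral>x. g x \<partial>measure_pmf M) = (\<integral>x. f x \<partial>measure_pmf M)"
    using S_invariant[OF _ f] by (simp add: LIMSEQ_const_iff)
  then show thesis
    using that[OF gB lim harm] by blast
qed

end

section \<open>Configurations and the product measure\<close>

lemma add_at_configs: "\<eta> \<in> configs \<Longrightarrow> add_at x \<eta> \<in> configs"
  unfolding configs_def add_at_def
  by (auto simp: PiE_def extensional_def intro: rev_finite_subset[of "insert x {x \<in> {1..}. \<eta> x \<noteq> 0}"])

lemma remove_at_configs: "\<eta> \<in> configs \<Longrightarrow> remove_at x \<eta> \<in> configs"
  unfolding configs_def remove_at_def
  by (auto simp: PiE_def extensional_def intro: rev_finite_subset[of "insert x {x \<in> {1..}. \<eta> x \<noteq> 0}"])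

lemma move_configs: "\<eta> \<in> configs \<Longrightarrow> move x y \<eta> \<in> configs"
  by (simp add: move_def add_at_configs remove_at_configs)

lemma inj_add_at: "inj (add_at x)"
proof (rule injI)
  fix \<eta> \<xi> assume "add_at x \<eta> = add_at x \<xi>"
  then have "\<eta> y = \<xi> y" for y
    by (auto simp: add_at_def split: if_splits dest: fun_cong[of _ _ y])
  then show "\<eta> = \<xi>" ..
qed

lemma remove_add_at: "remove_at x (add_at x \<eta>) = \<eta>"
  by (simp add: remove_at_def add_at_def)

lemma move_add_at: "move x y (add_at x \<eta>) = add_at y \<eta>"
  by (simp add: move_def remove_add_at)

lemma configs_supp:
  assumes "\<eta> \<in> configs"
  shows "\<exists>m. \<forall>x>m. \<eta> x = 0"
proof -
  have "finite {x \<in> {1..}. \<eta> x \<noteq> 0}" using assms by (simp add: configs_def)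
  then obtain m where m: "{x \<in> {1..}. \<eta> x \<noteq> 0} \<subseteq> {..m}"
    unfolding finite_nat_iff_bounded_le by blast
  have "\<eta> x = 0" if "m < x" for x
    using subsetD[OF m, of x] that by (cases "\<eta> x = 0") auto
  then show ?thesis by blast
qed

definition vacuum :: config where
  "vacuum = (\<lambda>x\<in>{1..}. 0)"

lemma vacuum_configs: "vacuum \<in> configs"
  by (simp add: vacuum_def configs_def)

lemma eq_vacuumI: "\<eta> \<in> configs \<Longrightarrow> (\<And>x. 1 \<le> x \<Longrightarrow> \<eta> x = 0) \<Longrightarrow> \<eta> = vacuum"
  unfolding configs_def vacuum_def by (auto simp: PiE_def extensional_def fun_eq_iff)

text \<open>Outer induction on the last site \<open>m\<close> that may be occupied, inner induction
  on the number \<open>k\<close> of particles there.\<close>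

lemma configs_induct [consumes 1, case_names vacuum add]:
  assumes "\<eta> \<in> configs"
    and vac: "Q vacuum"
    and add: "\<And>\<eta> x. \<eta> \<in> configs \<Longrightarrow> 1 \<le> x \<Longrightarrow> Q \<eta> \<Longrightarrow> Q (add_at x \<eta>)"
  shows "Q \<eta>"
proof -
  have "\<forall>\<eta>\<in>configs. (\<forall>x>m. \<eta> x = 0) \<longrightarrow> Q \<eta>" for m
  proof (induction m)
    case 0
    then show ?case using vac eq_vacuumI by (metis less_eq_Suc_le One_nat_def)
  next
    case (Suc m)
    have "\<forall>\<eta>\<in>configs. (\<forall>x>Suc m. \<eta> x = 0) \<longrightarrow> \<eta> (Suc m) = k \<longrightarrow> Q \<eta>" for k
    proof (induction k)
      case 0
      then show ?case using Suc.IH by (metis Suc_lessI)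
    next
      case (Suc k)
      show ?case
      proof (intro ballI impI)
        fix \<eta> assume \<eta>: "\<eta> \<in> configs" "\<forall>x>Suc m. \<eta> x = 0" "\<eta> (Suc m) = Suc k"
        have "remove_at (Suc m) \<eta> \<in> configs" "\<forall>x>Suc m. remove_at (Suc m) \<eta> x = 0"
          "remove_at (Suc m) \<eta> (Suc m) = k"
          using \<eta>(2,3) by (simp_all add: remove_at_configs \<eta>(1)) (simp_all add: remove_at_def)
        then have "Q (remove_at (Suc m) \<eta>)"
          using Suc.IH by blast
        then have "Q (add_at (Suc m) (remove_at (Suc m) \<eta>))"
          by (intro add remove_at_configs \<eta>(1)) auto
        also have "add_at (Suc m) (remove_at (Suc m) \<eta>) = \<eta>"
          using \<eta>(3) by (auto simp: add_at_def remove_at_def)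
        finally show "Q \<eta>" .
      qed
    qed
    then show ?case by blast
  qed
  then show ?thesis using assms(1) configs_supp by blast
qed

text \<open>Infinitely many occupied sites contribute at least 1 each, so the series diverges and
  \<open>infsum\<close> takes its default value 0.\<close>

lemma num_particles_outside:
  assumes "\<eta> \<in> {1..} \<rightarrow>\<^sub>E UNIV" "\<eta> \<notin> configs"
  shows "num_particles \<eta> = 0"
proof (rule ccontr)
  let ?T = "{x \<in> {1..}. \<eta> x \<noteq> 0}"
  assume "num_particles \<eta> \<noteq> 0"
  then have summ: "(\<lambda>x. real (\<eta> x)) summable_on {1..}"
    unfolding num_particles_def using infsum_not_exists by blast
  obtain k :: nat where k: "num_particles \<eta> < real k" using reals_Archimedean2 by blast
  have "infinite ?T" using assms by (simp add: configs_def)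
  then obtain F where F: "finite F" "card F = k" "F \<subseteq> ?T"
    using infinite_arbitrarily_large by blast
  have "real k = (\<Sum>x\<in>F. 1)" using F by simp
  also have "\<dots> \<le> (\<Sum>x\<in>F. real (\<eta> x))" using F by (intro sum_mono) auto
  also have "\<dots> \<le> num_particles \<eta>"
    unfolding num_particles_def using F summ by (intro finite_sum_le_infsum) auto
  finally show False using k by simp
qed

section \<open>Atoms and support of the product measure\<close>

context
  fixes p q :: real
  assumes p_nonneg: "0 \<le> p" and p_less_q: "p < q"
begin

abbreviation marginal :: "nat \<Rightarrow> nat measure" where
  "marginal x \<equiv> density (count_space UNIV) (\<lambda>k. ennreal ((p / q) ^ (k * x) * (1 - (p / q) ^ x)))"

lemma ratio: "0 \<le> p / q" "p / q < 1"
  using p_nonneg p_less_q by auto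

lemma prob_space_marginal:
  assumes "1 \<le> x"
  shows "prob_space (marginal x)"
proof
  let ?t = "(p / q) ^ x"
  have t: "0 \<le> ?t" "?t < 1"
    using ratio assms by (auto simp: power_less_one_iff simp del: power_divide)
  have "(\<lambda>k. ?t ^ k * (1 - ?t)) sums (1 / (1 - ?t) * (1 - ?t))"
    using t by (intro sums_mult2 geometric_sums) simp
  then have "(\<lambda>k. (p / q) ^ (k * x) * (1 - ?t)) sums 1"
    using t by (simp add: power_mult mult.commute[of _ x] del: power_divide)
  then have "(\<Sum>k. ennreal ((p / q) ^ (k * x) * (1 - ?t))) = ennreal 1"
    using t ratio by (intro suminf_ennreal_eq) (simp_all del: power_divide)
  then show "emeasure (marginal x) (space (marginal x)) = 1"
    by (simp add: emeasure_density nn_integral_count_space_nat del: power_divide)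
qed

lemma emeasure_marginal_singleton:
  "emeasure (marginal x) {k} = ennreal ((p / q) ^ (k * x) * (1 - (p / q) ^ x))"
  by (simp add: emeasure_density nn_integral_count_space_indicator[symmetric] del: power_divide)

abbreviation mu :: "config measure" where
  "mu \<equiv> mu_ZR p q"

lemma space_mu: "space mu = {1..} \<rightarrow>\<^sub>E UNIV"
  by (simp add: mu_ZR_def space_PiM)

lemma prob_space_mu: "prob_space mu"
  unfolding mu_ZR_def by (rule prob_space_PiM) (simp add: prob_space_marginal)

interpretation mu: prob_space mu
  by (rule prob_space_mu)

lemma cylinder_eq:
  "J \<subseteq> {1..} \<Longrightarrow> {\<omega> \<in> space mu. \<forall>x\<in>J. \<omega> x = \<eta> x} = prod_emb {1..} marginal J (\<Pi>\<^sub>E x\<in>J. {\<eta> x})"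
  by (auto simp: space_mu prod_emb_def space_PiM PiE_iff extensional_def)

lemma cylinder_sets:
  assumes "finite J" "J \<subseteq> {1..}"
  shows "{\<omega> \<in> space mu. \<forall>x\<in>J. \<omega> x = \<eta> x} \<in> sets mu"
  unfolding cylinder_eq[OF assms(2)] unfolding mu_ZR_def using assms by (intro sets_PiM_I) auto

lemma measure_cylinder:
  assumes "finite J" "J \<subseteq> {1..}"
  shows "measure mu {\<omega> \<in> space mu. \<forall>x\<in>J. \<omega> x = \<eta> x} = (\<Prod>x\<in>J. (p / q) ^ (\<eta> x * x) * (1 - (p / q) ^ x))"
proof -
  have nn: "0 \<le> (p / q) ^ (\<eta> x * x) * (1 - (p / q) ^ x)" for x
    using ratio by (simp add: power_le_one del: power_divide)
  have "emeasure mu {\<omega> \<in> space mu. \<forall>x\<in>J. \<omega> x = \<eta> x} = (\<Prod>x\<in>J. emeasure (marginal x) {\<eta> x})"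
    unfolding cylinder_eq[OF assms(2)] unfolding mu_ZR_def
    using assms prob_space_marginal by (intro emeasure_PiM_emb) auto
  also have "\<dots> = ennreal (\<Prod>x\<in>J. (p / q) ^ (\<eta> x * x) * (1 - (p / q) ^ x))"
    using nn by (simp add: emeasure_marginal_singleton prod_ennreal del: power_divide)
  finally show ?thesis
    using nn by (simp add: mu.emeasure_eq_measure prod_nonneg del: power_divide)
qed

lemma singleton_eq:
  assumes "\<eta> \<in> space mu"
  shows "{\<eta>} = (\<Inter>n. {\<omega> \<in> space mu. \<forall>x\<in>{1..n}. \<omega> x = \<eta> x})"
proof -
  have "\<omega> = \<eta>" if \<omega>: "\<omega> \<in> space mu" "\<And>n. \<forall>x\<in>{1..n}. \<omega> x = \<eta> x" for \<omega>
  proof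
    fix x show "\<omega> x = \<eta> x"
    proof (cases "1 \<le> x")
      case True
      then show ?thesis using \<omega>(2)[of x] by simp
    next
      case False
      then show ?thesis using assms \<omega>(1) by (simp add: space_mu PiE_iff extensional_def)
    qed
  qed
  then show ?thesis using assms by blast
qed

lemma singleton_sets:
  assumes "\<eta> \<in> space mu"
  shows "{\<eta>} \<in> sets mu"
  unfolding singleton_eq[OF assms]
proof (rule sets.countable_INT)
  show "range (\<lambda>n. {\<omega> \<in> space mu. \<forall>x\<in>{1..n}. \<omega> x = \<eta> x}) \<subseteq> sets mu"
    by (rule image_subsetI, rule cylinder_sets) auto
qed simp

lemma measure_singleton_LIMSEQ:
  assumes "\<eta> \<in> space mu"
  shows "(\<lambda>n. \<Prod>x\<in>{1..n}. (p / q) ^ (\<eta> x * x) * (1 - (p / q) ^ x)) \<longlonglongrightarrow> measure mu {\<eta>}"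
proof -
  let ?A = "\<lambda>n. {\<omega> \<in> space mu. \<forall>x\<in>{1..n}. \<omega> x = \<eta> x}"
  have "(\<lambda>n. measure mu (?A n)) \<longlonglongrightarrow> measure mu (\<Inter>n. ?A n)"
    by (rule mu.finite_Lim_measure_decseq) (auto simp: cylinder_sets decseq_def)
  then show ?thesis
    by (simp only: singleton_eq[OF assms, symmetric] measure_cylinder[OF finite_atLeastAtMost Icc_subset_Ici_iff[THEN iffD2, OF disjI2[OF order_refl]]])
qed

text \<open>An atom is the limit of finite products. Once \<open>y \<le> n\<close>, the extra
  particle multiplies exactly the factor at \<open>y\<close> by \<open>(p / q) ^ y\<close> and
  leaves all normalising factors alone, so the ratio survives the limit.\<close>

lemma measure_add_at:
  assumes "\<eta> \<in> configs" "1 \<le> y"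
  shows "measure mu {add_at y \<eta>} = (p / q) ^ y * measure mu {\<eta>}"
proof -
  let ?w = "\<lambda>\<eta> x. (p / q) ^ (\<eta> x * x) * (1 - (p / q) ^ x)"
  have sp: "\<eta> \<in> space mu" "add_at y \<eta> \<in> space mu"
    using assms add_at_configs[OF assms(1), of y] by (auto simp: space_mu configs_def)
  have eq: "(\<Prod>x\<in>{1..n}. ?w (add_at y \<eta>) x) = (p / q) ^ y * (\<Prod>x\<in>{1..n}. ?w \<eta> x)" if "y \<le> n" for n
  proof -
    have "(\<Prod>x\<in>{1..n}. ?w (add_at y \<eta>) x) = (\<Prod>x\<in>{1..n}. (if x = y then (p / q) ^ y else 1) * ?w \<eta> x)"
      using assms(2) by (intro prod.cong) (auto simp: add_at_def power_add simp del: power_divide)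
    then show ?thesis using that assms(2) by (simp add: prod.distrib del: power_divide)
  qed
  have "(\<lambda>n. \<Prod>x\<in>{1..n}. ?w (add_at y \<eta>) x) \<longlonglongrightarrow> (p / q) ^ y * measure mu {\<eta>}"
    by (rule Lim_transform_eventually[OF tendsto_mult[OF tendsto_const measure_singleton_LIMSEQ[OF sp(1)]]])
       (use eq in \<open>auto intro: eventually_sequentiallyI[of y]\<close>)
  then show ?thesis
    using LIMSEQ_unique measure_singleton_LIMSEQ[OF sp(2)] by blast
qed

text \<open>Borel-Cantelli: site \<open>x\<close> is occupied with probability
  \<open>(p / q) ^ x\<close>, which is summable because \<open>p < q\<close>.\<close>

lemma AE_configs: "AE \<eta> in mu. \<eta> \<in> configs"
proof -
  \<comment> \<open>The event that site \<open>Suc n\<close> is occupied; \<open>Suc\<close> because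
    0 is no site of the configuration. \<open>vacuum\<close> only supplies the pattern 0 of the
    cylinder.\<close>
  let ?A = "\<lambda>n. space mu - {\<omega> \<in> space mu. \<forall>x\<in>{Suc n}. \<omega> x = vacuum x}"
  have A: "?A n \<in> sets mu" for n
    by (intro sets.compl_sets cylinder_sets) auto
  have m: "measure mu (?A n) = (p / q) ^ Suc n" for n
    by (subst mu.prob_compl[OF cylinder_sets], simp, simp, subst measure_cylinder)
       (auto simp: vacuum_def simp del: power_divide)
  have "summable (\<lambda>n. (p / q) ^ Suc n)"
    using ratio by (subst summable_Suc_iff) (simp add: summable_geometric del: power_divide)
  then have "summable (\<lambda>n. measure mu (?A n))"
    unfolding m .
  then have "AE \<eta> in mu. \<forall>\<^sub>F n in sequentially. \<eta> \<in> space mu - ?A n"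
    by (intro borel_cantelli_AE1 A) (auto simp: mu.emeasure_eq_measure)
  then show ?thesis
  proof (rule AE_mp, intro AE_I2 impI)
    fix \<eta> assume \<eta>: "\<eta> \<in> space mu" "\<forall>\<^sub>F n in sequentially. \<eta> \<in> space mu - ?A n"
    then obtain k where "\<forall>n\<ge>k. \<eta> (Suc n) = 0"
      by (auto simp: eventually_sequentially vacuum_def)
    then have "{x \<in> {1..}. \<eta> x \<noteq> 0} \<subseteq> {..k}"
      by (auto simp: not_le) (metis Suc_le_D le_cases less_eq_Suc_le not_less_eq_eq)
    then show "\<eta> \<in> configs"
      using \<eta>(1) finite_subset by (auto simp: configs_def space_mu)
  qed
qed

end

section \<open>The product measure as a discrete distribution on the finite configurations\<close>

definition zr_pmf :: "real \<Rightarrow> real \<Rightarrow> config pmf" where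
  "zr_pmf p q = embed_pmf (\<lambda>\<eta>. if \<eta> \<in> configs then measure (mu_ZR p q) {\<eta>} else 0)"

context
  fixes p q :: real
  assumes p_nonneg: "0 \<le> p" and p_less_q: "p < q" and countable_configs: "countable configs"
begin

interpretation mu: prob_space "mu_ZR p q"
  by (rule prob_space_mu[OF p_nonneg p_less_q])

lemma configs_subset_sets:
  assumes "A \<subseteq> configs"
  shows "A \<in> sets (mu_ZR p q)"
proof (rule sets.countable)
  show "countable A" using assms countable_configs countable_subset by blast
  show "{\<eta>} \<in> sets (mu_ZR p q)" if "\<eta> \<in> A" for \<eta>
    using that assms
    by (intro singleton_sets[OF p_nonneg p_less_q]) (auto simp: space_mu[OF p_nonneg p_less_q] configs_def)
qed

lemma emeasure_configs_subset:
  assumes "A \<subseteq> configs"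
  shows "(\<integral>\<^sup>+\<eta>. ennreal (measure (mu_ZR p q) {\<eta>}) \<partial>count_space A) = emeasure (mu_ZR p q) A"
  unfolding mu.emeasure_eq_measure[symmetric]
  using assms countable_subset[OF assms countable_configs] configs_subset_sets
  by (intro emeasure_countable_singleton[symmetric]) auto

text \<open>The atoms in \<open>configs\<close> add up to 1: the set is countable and carries the
  product measure. Only this makes the value of \<open>embed_pmf\<close> meaningful.\<close>

lemma pmf_zr_pmf: "pmf (zr_pmf p q) \<eta> = (if \<eta> \<in> configs then measure (mu_ZR p q) {\<eta>} else 0)"
  unfolding zr_pmf_def
proof (rule pmf_embed_pmf)
  have "(\<integral>\<^sup>+\<eta>. ennreal (if \<eta> \<in> configs then measure (mu_ZR p q) {\<eta>} else 0) \<partial>count_space UNIV)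
      = (\<integral>\<^sup>+\<eta>. ennreal (measure (mu_ZR p q) {\<eta>}) \<partial>count_space configs)"
    by (subst (2) nn_integral_count_space_indicator) (auto intro!: nn_integral_cong)
  also have "\<dots> = 1"
    using mu.emeasure_eq_1_AE[OF configs_subset_sets AE_configs[OF p_nonneg p_less_q]]
    by (simp add: emeasure_configs_subset)
  finally show "(\<integral>\<^sup>+\<eta>. ennreal (if \<eta> \<in> configs then measure (mu_ZR p q) {\<eta>} else 0) \<partial>count_space UNIV) = 1" .
qed auto

lemma set_zr_pmf: "set_pmf (zr_pmf p q) \<subseteq> configs"
  by (auto simp: set_pmf_iff pmf_zr_pmf split: if_splits)

lemma pmf_add_at:
  "\<eta> \<in> configs \<Longrightarrow> 1 \<le> x \<Longrightarrow> pmf (zr_pmf p q) (add_at x \<eta>) = (p / q) ^ x * pmf (zr_pmf p q) \<eta>"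
  by (simp add: pmf_zr_pmf add_at_configs measure_add_at[OF p_nonneg p_less_q] del: power_divide)

lemma measure_zr_pmf:
  assumes "A \<subseteq> configs"
  shows "measure (measure_pmf (zr_pmf p q)) A = measure (mu_ZR p q) A"
proof -
  have "emeasure (measure_pmf (zr_pmf p q)) A = (\<integral>\<^sup>+\<eta>. ennreal (measure (mu_ZR p q) {\<eta>}) \<partial>count_space A)"
    unfolding nn_integral_pmf[symmetric] using assms by (intro nn_integral_cong) (auto simp: pmf_zr_pmf)
  then show ?thesis
    using emeasure_configs_subset[OF assms] by (simp add: measure_def)
qed

text \<open>All subsets of the countable set \<open>configs\<close> are measurable, and on its
  complement in the space the function is constantly 0.\<close>

lemma measurable_num_particles: "num_particles \<in> borel_measurable (mu_ZR p q)"
proof (rule measurableI)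
  fix B :: "real set"
  let ?sp = "space (mu_ZR p q)"
  have sp: "configs \<subseteq> ?sp" by (auto simp: space_mu[OF p_nonneg p_less_q] configs_def)
  have "num_particles -` B \<inter> ?sp
      = {\<eta> \<in> configs. num_particles \<eta> \<in> B} \<union> (if 0 \<in> B then ?sp - configs else {})"
  proof (rule set_eqI)
    fix \<eta>
    have "\<eta> \<in> ?sp \<Longrightarrow> \<eta> \<notin> configs \<Longrightarrow> num_particles \<eta> = 0"
      using num_particles_outside[of \<eta>] space_mu[OF p_nonneg p_less_q] by blast
    then show "\<eta> \<in> num_particles -` B \<inter> ?sp \<longleftrightarrow>
        \<eta> \<in> {\<eta> \<in> configs. num_particles \<eta> \<in> B} \<union> (if 0 \<in> B then ?sp - configs else {})"
      using sp by (cases "\<eta> \<in> configs") auto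
  qed
  then show "num_particles -` B \<inter> ?sp \<in> sets (mu_ZR p q)"
    using configs_subset_sets by auto
qed simp

lemma cdf_num_particles:
  "cdf (distr (mu_ZR p q) borel num_particles) c
    = (\<integral>\<eta>. of_bool (num_particles \<eta> \<le> c) \<partial>measure_pmf (zr_pmf p q))"
proof -
  let ?A = "{\<eta> \<in> configs. num_particles \<eta> \<le> c}"
  have "cdf (distr (mu_ZR p q) borel num_particles) c
      = measure (mu_ZR p q) (num_particles -` {..c} \<inter> space (mu_ZR p q))"
    unfolding cdf_def by (intro measure_distr measurable_num_particles) simp
  also have "\<dots> = measure (mu_ZR p q) ?A"
    using AE_configs[OF p_nonneg p_less_q] measurable_num_particles configs_subset_sets
    by (intro mu.finite_measure_eq_AE) (auto elim!: AE_mp)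
  also have "\<dots> = (\<integral>\<eta>. indicator ?A \<eta> \<partial>measure_pmf (zr_pmf p q))"
    by (simp add: measure_zr_pmf)
  also have "\<dots> = (\<integral>\<eta>. of_bool (num_particles \<eta> \<le> c) \<partial>measure_pmf (zr_pmf p q))"
    using set_zr_pmf by (intro integral_pmf_cong) auto
  finally show ?thesis .
qed

end

section \<open>The generator on local functions\<close>

text \<open>Locality with the explicit window \<open>{1..n}\<close>, which allows its growth under
  powers of the generator to be tracked.\<close>

definition depends_on :: "nat \<Rightarrow> (config \<Rightarrow> real) \<Rightarrow> bool" where
  "depends_on n f \<longleftrightarrow> (\<forall>\<eta>\<in>configs. \<forall>\<xi>\<in>configs. (\<forall>x\<in>{1..n}. \<eta> x = \<xi> x) \<longrightarrow> f \<eta> = f \<xi>)"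

lemma depends_onD:
  assumes "depends_on n f" "\<eta> \<in> configs" "\<xi> \<in> configs"
    and "\<And>x. 1 \<le> x \<Longrightarrow> x \<le> n \<Longrightarrow> \<eta> x = \<xi> x"
  shows "f \<eta> = f \<xi>"
proof -
  have "\<forall>x\<in>{1..n}. \<eta> x = \<xi> x" using assms(4) by simp
  then show ?thesis using assms(1-3) unfolding depends_on_def by blast
qed

lemma depends_on_local_fun: "depends_on n f \<Longrightarrow> local_fun f"
  unfolding depends_on_def local_fun_def
proof (intro exI[of _ "{1..n}"] conjI)
  show "finite {1..n}" "{1..n} \<subseteq> {1..}" by auto
qed

text \<open>The well at site 0 never empties, so it counts as occupied. Creation at site 1 thereby
  becomes an ordinary jump across the edge from 0 to 1.\<close>

definition occ :: "nat \<Rightarrow> config \<Rightarrow> bool" where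
  "occ x \<eta> \<longleftrightarrow> x = 0 \<or> 1 \<le> \<eta> x"

text \<open>Grouping the jumps by edges instead of by departure sites puts each jump next to its
  reverse, as detailed balance requires.\<close>

definition edge :: "real \<Rightarrow> real \<Rightarrow> (config \<Rightarrow> real) \<Rightarrow> nat \<Rightarrow> config \<Rightarrow> real" where
  "edge p q f x \<eta> = of_bool (occ x \<eta>) * (p * (f (move x (Suc x) \<eta>) - f \<eta>))
     + of_bool (occ (Suc x) \<eta>) * (q * (f (move (Suc x) x \<eta>) - f \<eta>))"

lemma move_far: "n < x \<Longrightarrow> n < y \<Longrightarrow> z \<le> n \<Longrightarrow> move x y \<eta> z = \<eta> z"
  by (auto simp: move_def add_at_def remove_at_def)

lemma depends_on_move_far:
  "depends_on n f \<Longrightarrow> \<eta> \<in> configs \<Longrightarrow> n < x \<Longrightarrow> n < y \<Longrightarrow> f (move x y \<eta>) = f \<eta>"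
  by (rule depends_onD) (auto simp: move_configs move_far)

text \<open>The left jump from \<open>Suc x\<close> is regrouped with the right jump from
  \<open>x\<close>; jumps between sites beyond \<open>n\<close> do not change \<open>f\<close>. The
  free bound \<open>m\<close> lets two functions with different windows be expanded over the same
  edges.\<close>

lemma gen_eq_sum_edge:
  assumes f: "depends_on n f" and \<eta>: "\<eta> \<in> configs" and "n \<le> m"
  shows "gen_ZR p q f \<eta> = (\<Sum>x\<le>m. edge p q f x \<eta>)"
proof -
  define a where "a x = of_bool (occ x \<eta>) * (p * (f (move x (Suc x) \<eta>) - f \<eta>))" for x
  define b where "b x = of_bool (occ (Suc x) \<eta>) * (q * (f (move (Suc x) x \<eta>) - f \<eta>))" for x
  define h where "h x = of_bool (1 \<le> \<eta> x) *
    (p * (f (move x (x + 1) \<eta>) - f \<eta>) + q * (f (move x (x - 1) \<eta>) - f \<eta>))" for x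
  have h_Suc: "h (Suc x) = a (Suc x) + b x" for x
    by (simp add: h_def a_def b_def occ_def algebra_simps)
  have h_far: "h x = 0" if "Suc m < x" for x
    using depends_on_move_far[OF f \<eta>, of x "x + 1"] depends_on_move_far[OF f \<eta>, of x "x - 1"]
      that \<open>n \<le> m\<close> by (simp add: h_def)
  have "(\<Sum>\<^sub>\<infinity>x\<in>{1..}. h x) = (\<Sum>\<^sub>\<infinity>x\<in>{1..Suc m}. h x)"
    by (rule infsum_cong_neutral) (auto intro: h_far)
  also have "\<dots> = (\<Sum>x\<in>{1..Suc m}. h x)" by simp
  also have "\<dots> = (\<Sum>x\<le>m. h (Suc x))"
    using sum.atLeast_Suc_atMost_Suc_shift[of h 0 m] by (simp add: atLeast0AtMost)
  finally have inf: "(\<Sum>\<^sub>\<infinity>x\<in>{1..}. h x) = (\<Sum>x\<le>m. a (Suc x)) + (\<Sum>x\<le>m. b x)"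
    by (simp add: h_Suc sum.distrib)
  \<comment> \<open>The boundary term left over by the index shift: a jump from \<open>Suc m\<close>
    to the next site, both outside the window.\<close>
  have "a (Suc m) = 0"
    using depends_on_move_far[OF f \<eta>, of "Suc m" "Suc (Suc m)"] \<open>n \<le> m\<close> by (simp add: a_def)
  then have "a 0 + (\<Sum>x\<le>m. a (Suc x)) = (\<Sum>x\<le>m. a x)"
    using sum.atMost_Suc_shift[of a m] by simp
  moreover have "gen_ZR p q f \<eta> = a 0 + (\<Sum>\<^sub>\<infinity>x\<in>{1..}. h x)"
    unfolding gen_ZR_def h_def a_def occ_def by simp
  ultimately show ?thesis
    unfolding inf edge_def a_def[symmetric] b_def[symmetric] by (simp add: sum.distrib)
qed

text \<open>The jump back from \<open>Suc n\<close> to \<open>n\<close> is possible only if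
  \<open>Suc n\<close> is occupied; this adds one site to the window.\<close>

lemma depends_on_gen:
  assumes f: "depends_on n f"
  shows "depends_on (Suc n) (gen_ZR p q f)"
  unfolding depends_on_def
proof (intro ballI impI)
  fix \<eta> \<xi> assume \<eta>: "\<eta> \<in> configs" and \<xi>: "\<xi> \<in> configs" and eq: "\<forall>x\<in>{1..Suc n}. \<eta> x = \<xi> x"
  have *: "\<eta> x = \<xi> x" if "1 \<le> x" "x \<le> Suc n" for x
    using eq that by (metis atLeastAtMost_iff)
  have "f \<eta> = f \<xi>"
    by (rule depends_onD[OF f \<eta> \<xi>]) (simp add: *)
  moreover have "f (move x y \<eta>) = f (move x y \<xi>)" for x y
    by (rule depends_onD[OF f move_configs[OF \<eta>] move_configs[OF \<xi>]])
       (auto simp: move_def add_at_def remove_at_def *)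
  moreover have "occ x \<eta> = occ x \<xi>" if "x \<le> Suc n" for x
    using *[of x] that by (cases "x = 0") (auto simp: occ_def)
  ultimately show "gen_ZR p q f \<eta> = gen_ZR p q f \<xi>"
    unfolding gen_eq_sum_edge[OF f \<eta> order_refl] gen_eq_sum_edge[OF f \<xi> order_refl]
    by (intro sum.cong) (auto simp: edge_def)
qed

lemma abs_le_on_edge:
  assumes f: "abs_le_on configs f B" and \<eta>: "\<eta> \<in> configs" and "0 \<le> p" "0 \<le> q" "p + q = 1"
  shows "\<bar>edge p q f x \<eta>\<bar> \<le> 2 * B"
proof -
  have d: "\<bar>f (move x y \<eta>) - f \<eta>\<bar> \<le> 2 * B" for x y
    using abs_le_onD[OF f \<eta>] abs_le_onD[OF f move_configs[OF \<eta>, of x y]] by linarith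
  have B: "0 \<le> B" by (rule abs_le_on_nonneg[OF f \<eta>])
  have t: "\<bar>of_bool b * (r * (f (move x y \<eta>) - f \<eta>))\<bar> \<le> r * (2 * B)" if "0 \<le> r" for b r x y
    using mult_left_mono[OF d[of x y] that] that B by (cases b) (simp_all add: abs_mult)
  have "\<bar>edge p q f x \<eta>\<bar> \<le> p * (2 * B) + q * (2 * B)"
    unfolding edge_def using assms by (intro order_trans[OF abs_triangle_ineq] add_mono t) auto
  also have "\<dots> = 2 * B" using assms(5) by (simp flip: distrib_right)
  finally show ?thesis .
qed

text \<open>The edges \<open>0, ..., n\<close> contribute at most \<open>2 * B\<close> each, as the
  rates add up to 1.\<close>

lemma abs_le_on_gen:
  assumes f: "depends_on n f" "abs_le_on configs f B" and "0 \<le> p" "0 \<le> q" "p + q = 1"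
  shows "abs_le_on configs (gen_ZR p q f) (2 * (real n + 1) * B)"
proof (rule abs_le_onI)
  fix \<eta> assume \<eta>: "\<eta> \<in> configs"
  have "\<bar>gen_ZR p q f \<eta>\<bar> \<le> (\<Sum>x\<le>n. \<bar>edge p q f x \<eta>\<bar>)"
    unfolding gen_eq_sum_edge[OF f(1) \<eta> order_refl] by (rule sum_abs)
  also have "\<dots> \<le> (\<Sum>x\<le>n. 2 * B)"
    using abs_le_on_edge[OF f(2) \<eta> assms(3-5)] by (intro sum_mono)
  finally show "\<bar>gen_ZR p q f \<eta>\<bar> \<le> 2 * (real n + 1) * B" by (simp add: algebra_simps)
qed

text \<open>The window has size \<open>n + j\<close> after \<open>j\<close> steps, so the next step
  costs a factor \<open>2 * (n + j + 1)\<close>; the product of these factors is the stated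
  one.\<close>

lemma iterate_gen:
  assumes f: "depends_on n f" "abs_le_on configs f B" and "0 \<le> p" "0 \<le> q" "p + q = 1"
  shows "depends_on (n + k) ((gen_ZR p q ^^ k) f)"
    and "abs_le_on configs ((gen_ZR p q ^^ k) f) (2 ^ k * (fact (n + k) / fact n) * B)"
proof -
  have "depends_on (n + k) ((gen_ZR p q ^^ k) f) \<and>
      abs_le_on configs ((gen_ZR p q ^^ k) f) (2 ^ k * (fact (n + k) / fact n) * B)"
  proof (induction k)
    case 0
    show ?case using f by simp
  next
    case (Suc k)
    then have IH: "depends_on (n + k) ((gen_ZR p q ^^ k) f)"
      "abs_le_on configs ((gen_ZR p q ^^ k) f) (2 ^ k * (fact (n + k) / fact n) * B)" by auto
    have eq: "2 * (real (n + k) + 1) * (2 ^ k * (fact (n + k) / fact n) * B)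
        = 2 ^ Suc k * (fact (n + Suc k) / fact n) * B"
      by (simp add: field_simps)
    show ?case
      using depends_on_gen[OF IH(1), of p q] abs_le_on_gen[OF IH assms(3-5)]
      unfolding eq by (simp del: fact_Suc power_Suc)
  qed
  then show "depends_on (n + k) ((gen_ZR p q ^^ k) f)"
    "abs_le_on configs ((gen_ZR p q ^^ k) f) (2 ^ k * (fact (n + k) / fact n) * B)" by auto
qed

text \<open>Emptying all sites beyond \<open>n\<close> replaces a bounded function by local ones
  with the same bound. A finite configuration is eventually fixed by \<open>trunc n\<close>, so they
  converge pointwise.\<close>

definition trunc :: "nat \<Rightarrow> config \<Rightarrow> config" where
  "trunc n \<eta> = (\<lambda>x\<in>{1..}. if x \<le> n then \<eta> x else 0)"

lemma trunc_configs: "trunc n \<eta> \<in> configs"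
  unfolding configs_def trunc_def by (auto intro: rev_finite_subset[of "{..n}"])

lemma depends_on_trunc: "depends_on n (\<lambda>\<eta>. f (trunc n \<eta>))"
  unfolding depends_on_def trunc_def by (auto intro!: arg_cong[of _ _ f])

lemma abs_le_on_trunc: "abs_le_on configs f B \<Longrightarrow> abs_le_on configs (\<lambda>\<eta>. f (trunc n \<eta>)) B"
  using trunc_configs by (auto simp: abs_le_on_def)

lemma trunc_LIMSEQ:
  assumes "\<eta> \<in> configs"
  shows "(\<lambda>n. f (trunc n \<eta>)) \<longlonglongrightarrow> (f \<eta> :: real)"
proof -
  obtain m where m: "\<forall>x>m. \<eta> x = 0" using configs_supp[OF assms] by blast
  have "trunc n \<eta> = \<eta>" if "m \<le> n" for n
    using assms m that by (auto simp: trunc_def configs_def fun_eq_iff PiE_iff extensional_def)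
  then show ?thesis
    by (intro tendsto_eventually) (auto intro: eventually_sequentiallyI[of m])
qed

section \<open>The Dirichlet form\<close>

text \<open>The argument is the configuration without the moving particle, so both directions of a
  jump give the same difference up to sign. At \<open>x = 0\<close> that particle sits in the well
  and \<open>add_at 0\<close> is the identity.\<close>

abbreviation grad :: "(config \<Rightarrow> real) \<Rightarrow> nat \<Rightarrow> config \<Rightarrow> real" where
  "grad f x \<eta> \<equiv> f (add_at x \<eta>) - f (add_at (Suc x) \<eta>)"

lemma abs_le_on_add_at: "abs_le_on configs f B \<Longrightarrow> abs_le_on configs (\<lambda>\<eta>. f (add_at x \<eta>)) B"
  using add_at_configs by (auto simp: abs_le_on_def)

lemma abs_le_on_grad: "abs_le_on configs f B \<Longrightarrow> abs_le_on configs (grad f x) (B + B)"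
  by (intro abs_le_on_diff abs_le_on_add_at)

lemma abs_le_on_move: "abs_le_on configs f B \<Longrightarrow> abs_le_on configs (\<lambda>\<eta>. f (move x y \<eta>)) B"
  using move_configs by (auto simp: abs_le_on_def)

lemma abs_le_on_occ: "abs_le_on configs F B \<Longrightarrow> abs_le_on configs (\<lambda>\<eta>. of_bool (occ x \<eta>) * F \<eta>) B"
  unfolding abs_le_on_def by (auto simp: abs_mult)

context
  fixes p q :: real
  assumes p_nonneg: "0 \<le> p" and p_less_q: "p < q" and countable_configs: "countable configs"
begin

abbreviation "\<nu> \<equiv> measure_pmf (zr_pmf p q)"

lemmas zr_facts = p_nonneg p_less_q countable_configs

lemma integrable_zr: "abs_le_on configs f B \<Longrightarrow> integrable \<nu> f"
  by (rule integrable_pmf_abs_le_on[OF set_zr_pmf[OF zr_facts]])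

text \<open>Change of variables: for \<open>x \<noteq> 0\<close>, \<open>add_at x\<close> maps the
  configurations bijectively onto those occupied at \<open>x\<close> and multiplies the weight by
  \<open>(p / q) ^ x\<close>.\<close>

lemma integral_occ:
  assumes "abs_le_on configs F B"
  shows "(\<integral>\<eta>. of_bool (occ x \<eta>) * F \<eta> \<partial>\<nu>) = (p / q) ^ x * (\<integral>\<eta>. F (add_at x \<eta>) \<partial>\<nu>)"
proof (cases "x = 0")
  case True
  then show ?thesis by (simp add: occ_def add_at_def)
next
  case False
  let ?M = "zr_pmf p q"
  have dens: "(\<integral>\<eta>. G \<eta> \<partial>measure_pmf M') = (\<integral>\<eta>. pmf M' \<eta> * G \<eta> \<partial>count_space UNIV)"
    for M' :: "config pmf" and G :: "config \<Rightarrow> real"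
    by (subst measure_pmf_eq_density, subst integral_density) auto
  \<comment> \<open>The change of variables at the level of weights: both sides vanish when
    \<open>x\<close> is empty, and otherwise the preimage of \<open>\<xi>\<close> is
    \<open>remove_at x \<xi>\<close>.\<close>
  have pw: "of_bool (occ x \<xi>) * pmf ?M \<xi> = (p / q) ^ x * pmf (map_pmf (add_at x) ?M) \<xi>" for \<xi>
  proof (cases "occ x \<xi>")
    case True
    then have eq: "\<xi> = add_at x (remove_at x \<xi>)"
      using False by (auto simp: occ_def add_at_def remove_at_def)
    have "pmf (map_pmf (add_at x) ?M) \<xi> = pmf ?M (remove_at x \<xi>)"
      by (subst eq) (rule pmf_map_inj'[OF inj_add_at])
    moreover have "pmf ?M \<xi> = (p / q) ^ x * pmf ?M (remove_at x \<xi>)"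
    proof (cases "\<xi> \<in> configs")
      case True
      have "1 \<le> x" using \<open>x \<noteq> 0\<close> by simp
      from pmf_add_at[OF zr_facts remove_at_configs[OF True] this, of x]
      show ?thesis unfolding eq[symmetric] .
    next
      case out: False
      then have "remove_at x \<xi> \<notin> configs" using eq add_at_configs by metis
      then show ?thesis using out by (simp add: pmf_zr_pmf[OF zr_facts])
    qed
    ultimately show ?thesis using True by simp
  next
    case no: False
    then have "\<xi> \<notin> add_at x ` set_pmf ?M" using False by (auto simp: occ_def add_at_def)
    then show ?thesis using no by (simp add: pmf_eq_0_set_pmf)
  qed
  have "(\<integral>\<eta>. of_bool (occ x \<eta>) * F \<eta> \<partial>\<nu>)
      = (\<integral>\<eta>. (p / q) ^ x * (pmf (map_pmf (add_at x) ?M) \<eta> * F \<eta>) \<partial>count_space UNIV)"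
    unfolding dens
  proof (rule Bochner_Integration.integral_cong[OF refl])
    fix \<eta>
    show "pmf ?M \<eta> * (of_bool (occ x \<eta>) * F \<eta>) = (p / q) ^ x * (pmf (map_pmf (add_at x) ?M) \<eta> * F \<eta>)"
      using arg_cong[OF pw[of \<eta>], of "\<lambda>u. u * F \<eta>"] by (simp only: mult_ac)
  qed
  also have "\<dots> = (p / q) ^ x * (\<integral>\<eta>. F \<eta> \<partial>measure_pmf (map_pmf (add_at x) ?M))"
    unfolding dens by simp
  finally show ?thesis by simp
qed

text \<open>Detailed balance, in the form \<open>q * (p / q) ^ Suc x = p * (p / q) ^ x\<close>.\<close>

lemma integral_edge:
  assumes f: "abs_le_on configs f B" and g: "abs_le_on configs g C"
  shows "integrable \<nu> (\<lambda>\<eta>. g \<eta> * edge p q f x \<eta>)"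
    and "(\<integral>\<eta>. g \<eta> * edge p q f x \<eta> \<partial>\<nu>) = - (p * (p / q) ^ x * (\<integral>\<eta>. grad g x \<eta> * grad f x \<eta> \<partial>\<nu>))"
proof -
  define F where "F y z \<eta> = g \<eta> * (f (move y z \<eta>) - f \<eta>)" for y z \<eta>
  have F: "abs_le_on configs (F y z) (C * (B + B))" for y z
    unfolding F_def by (intro abs_le_on_mult g abs_le_on_diff abs_le_on_move f)
  have split: "(\<lambda>\<eta>. g \<eta> * edge p q f x \<eta>) =
      (\<lambda>\<eta>. p * (of_bool (occ x \<eta>) * F x (Suc x) \<eta>) + q * (of_bool (occ (Suc x) \<eta>) * F (Suc x) x \<eta>))"
    by (simp add: fun_eq_iff edge_def F_def algebra_simps)
  note i = integrable_zr[OF abs_le_on_occ[OF F]]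
  show "integrable \<nu> (\<lambda>\<eta>. g \<eta> * edge p q f x \<eta>)"
    unfolding split using i by simp
  have "(\<integral>\<eta>. g \<eta> * edge p q f x \<eta> \<partial>\<nu>)
      = p * (\<integral>\<eta>. of_bool (occ x \<eta>) * F x (Suc x) \<eta> \<partial>\<nu>)
        + q * (\<integral>\<eta>. of_bool (occ (Suc x) \<eta>) * F (Suc x) x \<eta> \<partial>\<nu>)"
    unfolding split using i by simp
  also have "\<dots> = p * (p / q) ^ x * (\<integral>\<eta>. F x (Suc x) (add_at x \<eta>) \<partial>\<nu>)
      + p * (p / q) ^ x * (\<integral>\<eta>. F (Suc x) x (add_at (Suc x) \<eta>) \<partial>\<nu>)"
    using p_nonneg p_less_q by (simp add: integral_occ[OF F] del: power_divide)
  also have "\<dots> = p * (p / q) ^ x *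
      (\<integral>\<eta>. F x (Suc x) (add_at x \<eta>) + F (Suc x) x (add_at (Suc x) \<eta>) \<partial>\<nu>)"
    using integrable_zr[OF abs_le_on_add_at[OF F]] by (simp add: algebra_simps del: power_divide)
  \<comment> \<open>After the shifts both terms involve the same two configurations \<open>a\<close>
    and \<open>b\<close>, and \<open>g a * (f b - f a) + g b * (f a - f b) = - ((g a - g b) * (f a -
    f b))\<close>.\<close>
  also have "(\<integral>\<eta>. F x (Suc x) (add_at x \<eta>) + F (Suc x) x (add_at (Suc x) \<eta>) \<partial>\<nu>)
      = (\<integral>\<eta>. - (grad g x \<eta> * grad f x \<eta>) \<partial>\<nu>)"
    by (intro Bochner_Integration.integral_cong refl) (simp add: F_def move_add_at algebra_simps)
  finally show "(\<integral>\<eta>. g \<eta> * edge p q f x \<eta> \<partial>\<nu>) = - (p * (p / q) ^ x * (\<integral>\<eta>. grad g x \<eta> * grad f x \<eta> \<partial>\<nu>))"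
    by simp
qed

text \<open>The Dirichlet form as a sum over edges. Locality is asked of \<open>f\<close> alone, so
  that \<open>g\<close> can later be a bounded harmonic function.\<close>

lemma integral_gen:
  assumes f: "depends_on n f" "abs_le_on configs f B" and g: "abs_le_on configs g C" and "n \<le> m"
  shows "(\<integral>\<eta>. g \<eta> * gen_ZR p q f \<eta> \<partial>\<nu>) = - (\<Sum>x\<le>m. p * (p / q) ^ x * (\<integral>\<eta>. grad g x \<eta> * grad f x \<eta> \<partial>\<nu>))"
proof -
  have "(\<integral>\<eta>. g \<eta> * gen_ZR p q f \<eta> \<partial>\<nu>) = (\<integral>\<eta>. (\<Sum>x\<le>m. g \<eta> * edge p q f x \<eta>) \<partial>\<nu>)"
    using set_zr_pmf[OF zr_facts] gen_eq_sum_edge[OF f(1) _ \<open>n \<le> m\<close>]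
    by (intro integral_pmf_cong) (auto simp: sum_distrib_left)
  also have "\<dots> = (\<Sum>x\<le>m. \<integral>\<eta>. g \<eta> * edge p q f x \<eta> \<partial>\<nu>)"
    by (intro Bochner_Integration.integral_sum integral_edge[OF f(2) g])
  finally show ?thesis
    by (simp add: integral_edge[OF f(2) g] sum_negf del: power_divide)
qed

lemma gen_symmetric:
  assumes f: "depends_on n f" "abs_le_on configs f B" and g: "depends_on m g" "abs_le_on configs g C"
  shows "(\<integral>\<eta>. g \<eta> * gen_ZR p q f \<eta> \<partial>\<nu>) = (\<integral>\<eta>. f \<eta> * gen_ZR p q g \<eta> \<partial>\<nu>)"
  using integral_gen[OF f g(2), of "max n m"] integral_gen[OF g f(2), of "max n m"]
  by (simp add: mult.commute del: power_divide)

text \<open>One factor of the generator is moved across at a time; \<open>g\<close> is generalised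
  because its image under the generator, with a larger window, takes its place.\<close>

lemma iterate_gen_symmetric:
  assumes "depends_on n f" "abs_le_on configs f B" "depends_on m g" "abs_le_on configs g C" "p + q = 1"
  shows "(\<integral>\<eta>. g \<eta> * (gen_ZR p q ^^ k) f \<eta> \<partial>\<nu>) = (\<integral>\<eta>. f \<eta> * (gen_ZR p q ^^ k) g \<eta> \<partial>\<nu>)"
  using assms
proof (induction k arbitrary: m g C)
  case 0
  then show ?case by (simp add: mult.commute)
next
  case (Suc k)
  have q: "0 \<le> q" using p_nonneg p_less_q by simp
  note Lf = iterate_gen[OF Suc.prems(1,2) p_nonneg q Suc.prems(5), of k]
  have "(\<integral>\<eta>. g \<eta> * (gen_ZR p q ^^ Suc k) f \<eta> \<partial>\<nu>) = (\<integral>\<eta>. (gen_ZR p q ^^ k) f \<eta> * gen_ZR p q g \<eta> \<partial>\<nu>)"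
    using gen_symmetric[OF Lf Suc.prems(3,4)] by simp
  also have "\<dots> = (\<integral>\<eta>. f \<eta> * (gen_ZR p q ^^ k) (gen_ZR p q g) \<eta> \<partial>\<nu>)"
    using Suc.IH[OF Suc.prems(1,2) depends_on_gen[OF Suc.prems(3)]
        abs_le_on_gen[OF Suc.prems(3,4) p_nonneg q Suc.prems(5)] Suc.prems(5)]
    by (simp add: mult.commute)
  finally show ?case by (simp add: funpow_swap1)
qed

end

section \<open>Reversibility of the semigroup\<close>

context zero_range_process
begin

text \<open>The generator limit in the form of a first-order expansion at time 0, with an error
  uniform over all configurations.\<close>

lemma S_gen_error:
  assumes f: "depends_on n f" "abs_le_on configs f B" and "0 < e"
  obtains d where "0 < d"
    "\<And>h. 0 < h \<Longrightarrow> h < d \<Longrightarrow> abs_le_on configs (\<lambda>\<eta>. S h f \<eta> - f \<eta> - h * gen_ZR p q f \<eta>) (e * h)"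
proof -
  have "bounded (f ` configs)"
    using f(2) by (auto simp: bounded_iff abs_le_on_def)
  then have "uniform_limit configs (\<lambda>t \<eta>. (S t f \<eta> - f \<eta>) / t) (gen_ZR p q f) (at_right 0)"
    by (rule generator[OF depends_on_local_fun[OF f(1)]])
  from uniform_limitD[OF this \<open>0 < e\<close>] obtain d where "0 < d" and
    d: "\<And>h. 0 < h \<Longrightarrow> h < d \<Longrightarrow> \<forall>\<eta>\<in>configs. dist ((S h f \<eta> - f \<eta>) / h) (gen_ZR p q f \<eta>) < e"
    unfolding eventually_at_right_field by auto
  show thesis
  proof (rule that[OF \<open>0 < d\<close>], rule abs_le_onI)
    fix h \<eta> assume h: "0 < h" "h < d" and \<eta>: "\<eta> \<in> configs"
    have "S h f \<eta> - f \<eta> - h * gen_ZR p q f \<eta> = h * ((S h f \<eta> - f \<eta>) / h - gen_ZR p q f \<eta>)"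
      using h(1) by (simp add: field_simps)
    then have "\<bar>S h f \<eta> - f \<eta> - h * gen_ZR p q f \<eta>\<bar> = h * \<bar>(S h f \<eta> - f \<eta>) / h - gen_ZR p q f \<eta>\<bar>"
      using h(1) by (simp only: abs_mult abs_of_pos)
    also have "\<dots> \<le> h * e"
      using d[OF h] \<eta> h(1) by (intro mult_left_mono) (auto simp: dist_real_def less_imp_le)
    finally show "\<bar>S h f \<eta> - f \<eta> - h * gen_ZR p q f \<eta>\<bar> \<le> e * h" by (simp add: mult.commute)
  qed
qed

end

section \<open>Time derivatives and the exponential series of the semigroup\<close>

locale subcritical_zrp = zero_range_process p q N P Z
  for p q :: real and N :: "'s measure" and P :: "config \<Rightarrow> 's measure"
    and Z :: "real \<Rightarrow> 's \<Rightarrow> config" +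
  assumes p_nonneg: "0 \<le> p" and p_q: "p + q = 1" and p_less_q: "p < q"
begin

lemma q_nonneg: "0 \<le> q" using p_nonneg p_less_q by simp

abbreviation "L \<equiv> gen_ZR p q"
abbreviation "M \<equiv> zr_pmf p q"

lemmas zr = p_nonneg p_less_q countable_states
lemmas abs_le_on_L = abs_le_on_gen[OF _ _ p_nonneg q_nonneg p_q]
lemmas iterate_L = iterate_gen[OF _ _ p_nonneg q_nonneg p_q]

lemma S_continuous_0:
  assumes f: "depends_on n f" "abs_le_on configs f B" and "0 < e"
  obtains d where "0 < d" "\<And>h. 0 < h \<Longrightarrow> h < d \<Longrightarrow> abs_le_on configs (\<lambda>\<eta>. S h f \<eta> - f \<eta>) e"
proof -
  define C where "C = 2 * (real n + 1) * B"
  have Lf: "abs_le_on configs (L f) C"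
    unfolding C_def by (rule abs_le_on_L[OF f])
  have C: "0 \<le> C" by (rule abs_le_on_nonneg[OF Lf vacuum_configs])
  obtain d where "0 < d" and
    d: "\<And>h. 0 < h \<Longrightarrow> h < d \<Longrightarrow> abs_le_on configs (\<lambda>\<eta>. S h f \<eta> - f \<eta> - h * L f \<eta>) (1 * h)"
    using S_gen_error[OF f, of 1] by auto
  \<comment> \<open>The increment is at most the expansion error \<open>h\<close> plus
    \<open>h * C\<close>, and \<open>h * (1 + C) \<le> e\<close> for \<open>h\<close> below
    \<open>e / (C + 1)\<close>.\<close>
  show thesis
  proof (rule that[of "min d (e / (C + 1))"])
    show "0 < min d (e / (C + 1))" using \<open>0 < d\<close> \<open>0 < e\<close> C by simp
  next
    fix h assume h: "0 < h" "h < min d (e / (C + 1))"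
    show "abs_le_on configs (\<lambda>\<eta>. S h f \<eta> - f \<eta>) e"
    proof (rule abs_le_onI)
      fix \<eta> assume \<eta>: "\<eta> \<in> configs"
      have "\<bar>S h f \<eta> - f \<eta>\<bar> \<le> \<bar>S h f \<eta> - f \<eta> - h * L f \<eta>\<bar> + h * \<bar>L f \<eta>\<bar>"
        using abs_triangle_ineq[of "S h f \<eta> - f \<eta> - h * L f \<eta>" "h * L f \<eta>"] h(1)
        by (simp add: abs_mult)
      also have "\<dots> \<le> 1 * h + h * C"
        using h abs_le_onD[OF d \<eta>] abs_le_onD[OF Lf \<eta>] by (intro add_mono mult_left_mono) auto
      also have "\<dots> \<le> e" using h C by (simp add: field_simps)
      finally show "\<bar>S h f \<eta> - f \<eta>\<bar> \<le> e" .
    qed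
  qed
qed

text \<open>Applying the contraction \<open>S s\<close> to the expansion at time 0 gives forward
  increments with an error uniform in \<open>s\<close>. Backward increments follow from this
  uniformity and the continuity in time of \<open>S s (L f)\<close>.\<close>

lemma S_has_derivative:
  assumes f: "depends_on n f" "abs_le_on configs f B" and \<eta>: "\<eta> \<in> configs" and t: "0 \<le> t"
  shows "((\<lambda>s. S s f \<eta>) has_field_derivative S t (L f) \<eta>) (at t within {0..})"
  unfolding has_field_derivative_def has_derivative_within_alt
proof (intro conjI allI impI bounded_linear_mult_right)
  fix e :: real assume "0 < e"
  define C where "C = 2 * (real n + 1) * B"
  have Lf: "abs_le_on configs (L f) C"
    unfolding C_def by (rule abs_le_on_L[OF f])
  define u where "u h \<xi> = S h f \<xi> - f \<xi> - h * L f \<xi>" for h \<xi>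
  define v where "v h \<xi> = S h (L f) \<xi> - L f \<xi>" for h \<xi>
  obtain d1 where d1: "0 < d1" "\<And>h. 0 < h \<Longrightarrow> h < d1 \<Longrightarrow> abs_le_on configs (u h) (e / 2 * h)"
    unfolding u_def using S_gen_error[OF f, of "e / 2"] \<open>0 < e\<close> by auto
  obtain d2 where d2: "0 < d2" "\<And>h. 0 < h \<Longrightarrow> h < d2 \<Longrightarrow> abs_le_on configs (v h) (e / 2)"
    unfolding v_def using S_continuous_0[OF depends_on_gen[OF f(1)] Lf, of "e / 2"] \<open>0 < e\<close> by auto
  have Su: "S s (u h) \<eta> = S (s + h) f \<eta> - S s f \<eta> - h * S s (L f) \<eta>" if "0 \<le> s" "0 \<le> h" for s h
  proof -
    note Shf = abs_le_on_S[OF that(2) f(2)]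
    have "S s (u h) \<eta> = S s (\<lambda>\<xi>. S h f \<xi> - f \<xi>) \<eta> - S s (\<lambda>\<xi>. h * L f \<xi>) \<eta>"
      unfolding u_def by (rule S_diff[OF that(1) \<eta> abs_le_on_diff[OF Shf f(2)] abs_le_on_cmult[OF Lf]])
    also have "S s (\<lambda>\<xi>. S h f \<xi> - f \<xi>) \<eta> = S s (S h f) \<eta> - S s f \<eta>"
      by (rule S_diff[OF that(1) \<eta> Shf f(2)])
    finally show ?thesis
      by (simp add: S_cmult S_semigroup[OF that \<eta> f(2)])
  qed
  have Sv: "S s (v h) \<eta> = S (s + h) (L f) \<eta> - S s (L f) \<eta>" if "0 \<le> s" "0 \<le> h" for s h
    unfolding v_def using S_diff[OF that(1) \<eta> abs_le_on_S[OF that(2) Lf] Lf]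
    by (simp add: S_semigroup[OF that \<eta> Lf])
  have fwd: "\<bar>S (s + h) f \<eta> - S s f \<eta> - h * S s (L f) \<eta>\<bar> \<le> e / 2 * h"
    if "0 \<le> s" "0 < h" "h < d1" for s h
    using S_abs_le[OF that(1) \<eta> d1(2)[OF that(2,3)]] Su[of s h] that by simp
  have der: "\<bar>S (s + h) (L f) \<eta> - S s (L f) \<eta>\<bar> \<le> e / 2" if "0 \<le> s" "0 < h" "h < d2" for s h
    using S_abs_le[OF that(1) \<eta> d2(2)[OF that(2,3)]] Sv[of s h] that by simp
  have "\<bar>S y f \<eta> - S t f \<eta> - S t (L f) \<eta> * (y - t)\<bar> \<le> e * \<bar>y - t\<bar>"
    if y: "0 \<le> y" "\<bar>y - t\<bar> < min d1 d2" for y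
  proof (cases y t rule: linorder_cases)
    case less
    let ?h = "t - y"
    have h: "0 < ?h" "?h < d1" "?h < d2" using less y by auto
    \<comment> \<open>The backward increment from \<open>t\<close> is read as a forward increment
      from \<open>y\<close>, at the price of exchanging \<open>S t (L f)\<close> for
      \<open>S y (L f)\<close>.\<close>
    have eq: "S y f \<eta> - S t f \<eta> - S t (L f) \<eta> * (y - t)
        = ?h * (S (y + ?h) (L f) \<eta> - S y (L f) \<eta>) - (S (y + ?h) f \<eta> - S y f \<eta> - ?h * S y (L f) \<eta>)"
      by (simp add: algebra_simps)
    have "\<bar>S y f \<eta> - S t f \<eta> - S t (L f) \<eta> * (y - t)\<bar> \<le> ?h * \<bar>S (y + ?h) (L f) \<eta> - S y (L f) \<eta>\<bar>
        + \<bar>S (y + ?h) f \<eta> - S y f \<eta> - ?h * S y (L f) \<eta>\<bar>"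
      unfolding eq by (rule order_trans[OF abs_triangle_ineq4]) (use h(1) in \<open>simp only: abs_mult abs_of_pos order_refl\<close>)
    also have "\<dots> \<le> ?h * (e / 2) + e / 2 * ?h"
      by (intro add_mono mult_left_mono fwd[OF y(1) h(1,2)] der[OF y(1) h(1,3)] less_imp_le[OF h(1)])
    also have "\<dots> = e * \<bar>y - t\<bar>" using less by simp
    finally show ?thesis .
  next
    case equal
    then show ?thesis by simp
  next
    case greater
    then have "\<bar>S y f \<eta> - S t f \<eta> - S t (L f) \<eta> * (y - t)\<bar> \<le> e / 2 * (y - t)"
      using fwd[OF t, of "y - t"] y by (simp add: mult.commute)
    also have "\<dots> \<le> e * \<bar>y - t\<bar>" using greater \<open>0 < e\<close> by simp
    finally show ?thesis .
  qed
  then show "\<exists>d>0. \<forall>y\<in>{0..}. norm (y - t) < d \<longrightarrow>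
      norm (S y f \<eta> - S t f \<eta> - S t (L f) \<eta> * (y - t)) \<le> e * norm (y - t)"
    using d1(1) d2(1) by (intro exI[of _ "min d1 d2"]) auto
qed

text \<open>Since \<open>L\<close> enlarges the range of a local function by one site only, \<open>\<parallel>L\<^sup>k f\<parallel>\<close> grows like
  \<open>2\<^sup>k k!\<close> up to a polynomial factor: the exponential series of the semigroup converges for small
  times, and the generator on local functions determines the semigroup.\<close>

definition taylor_rem :: "nat \<Rightarrow> real \<Rightarrow> real \<Rightarrow> nat \<Rightarrow> real" where
  "taylor_rem n B t k = 2 ^ Suc k * (fact (n + Suc k) / fact n) * B * t ^ Suc k / fact k"

text \<open>Taylor's formula for \<open>s \<mapsto> S s f \<eta>\<close>: its \<open>i\<close>-th
  derivative is \<open>S s ((L ^^ i) f) \<eta>\<close>, and contraction carries the bounds on the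
  powers of \<open>L\<close> over to all times.\<close>

lemma S_taylor:
  assumes f: "depends_on n f" "abs_le_on configs f B" and \<eta>: "\<eta> \<in> configs" and t: "0 \<le> t"
  shows "\<bar>S t f \<eta> - (\<Sum>i\<le>k. (L ^^ i) f \<eta> * t ^ i / fact i)\<bar> \<le> taylor_rem n B t k"
proof -
  note Lf = iterate_L[OF f]
  have "norm (S t ((L ^^ 0) f) \<eta> - (\<Sum>i\<le>k. S 0 ((L ^^ i) f) \<eta> * (t - 0) ^ i / fact i))
      \<le> (2 ^ Suc k * (fact (n + Suc k) / fact n) * B) * norm (t - 0) ^ Suc k / fact k"
  proof (rule field_Taylor[where S = "{0..}" and f = "\<lambda>i s. S s ((L ^^ i) f) \<eta>"])
    show "((\<lambda>s. S s ((L ^^ i) f) \<eta>) has_field_derivative S x ((L ^^ Suc i) f) \<eta>) (at x within {0..})"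
      if "x \<in> {0..}" for i x
      using S_has_derivative[OF Lf \<eta>, of x i] that by simp
    show "norm (S x ((L ^^ Suc k) f) \<eta>) \<le> 2 ^ Suc k * (fact (n + Suc k) / fact n) * B"
      if "x \<in> {0..}" for x
      using S_abs_le[OF _ \<eta> Lf(2), of x "Suc k"] that by simp
  qed (use t in auto)
  then show ?thesis
    using t by (simp add: taylor_rem_def S_zero[OF \<eta>])
qed

lemma taylor_rem_LIMSEQ:
  assumes "0 \<le> t" "t \<le> 1 / 4"
  shows "taylor_rem n B t \<longlonglongrightarrow> 0"
proof (rule summable_LIMSEQ_zero, rule summable_ratio_test)
  \<comment> \<open>From here on \<open>(n + k + 2) / (k + 1) \<le> 3 / 2\<close>, so with
    \<open>t \<le> 1 / 4\<close> the ratio of consecutive remainders is at most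
    \<open>3 / 4\<close>.\<close>
  fix k :: nat assume k: "2 * n + 1 \<le> k"
  have "taylor_rem n B t (Suc k) = (2 * t * (real (n + k + 2) / real (k + 1))) * taylor_rem n B t k"
    by (simp add: taylor_rem_def field_simps)
  also have "norm \<dots> = (2 * t * (real (n + k + 2) / real (k + 1))) * norm (taylor_rem n B t k)"
    using assms by (simp add: abs_mult)
  also have "\<dots> \<le> (2 * (1 / 4) * (3 / 2)) * norm (taylor_rem n B t k)"
    using assms k by (intro mult_right_mono mult_mono) (auto simp: field_simps)
  finally show "norm (taylor_rem n B t (Suc k)) \<le> 3 / 4 * norm (taylor_rem n B t k)"
    by simp
qed simp

text \<open>The Taylor sums differ from the bounded \<open>S t f\<close> by a convergent, hence
  bounded, remainder. So dominated convergence applies, and the pairing is expressed through powers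
  of \<open>L\<close> alone.\<close>

lemma S_series:
  assumes f: "depends_on n f" "abs_le_on configs f B" and g: "abs_le_on configs g C"
    and t: "0 \<le> t" "t \<le> 1 / 4"
  shows "(\<lambda>k. \<Sum>i\<le>k. (\<integral>\<eta>. g \<eta> * (L ^^ i) f \<eta> \<partial>measure_pmf M) * (t ^ i / fact i))
    \<longlonglongrightarrow> (\<integral>\<eta>. g \<eta> * S t f \<eta> \<partial>measure_pmf M)"
proof -
  define T where "T k \<eta> = (\<Sum>i\<le>k. (L ^^ i) f \<eta> * t ^ i / fact i)" for k \<eta>
  have err: "\<bar>S t f \<eta> - T k \<eta>\<bar> \<le> taylor_rem n B t k" if "\<eta> \<in> configs" for k \<eta>
    unfolding T_def by (rule S_taylor[OF f that t(1)])
  have "Bseq (taylor_rem n B t)"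
    using taylor_rem_LIMSEQ[OF t] convergentI convergent_imp_Bseq by blast
  then obtain K where K: "\<And>k. \<bar>taylor_rem n B t k\<bar> \<le> K"
    unfolding Bseq_def by auto
  have T: "abs_le_on configs (T k) (B + K)" for k
  proof (rule abs_le_onI)
    fix \<eta> assume \<eta>: "\<eta> \<in> configs"
    show "\<bar>T k \<eta>\<bar> \<le> B + K"
      using err[OF \<eta>, of k] K[of k] S_abs_le[OF t(1) \<eta> f(2)] by linarith
  qed
  have lim: "(\<lambda>k. T k \<eta>) \<longlonglongrightarrow> S t f \<eta>" if "\<eta> \<in> configs" for \<eta>
  proof (rule Lim_transform2[OF tendsto_const])
    show "(\<lambda>k. S t f \<eta> - T k \<eta>) \<longlonglongrightarrow> 0"
      by (rule Lim_null_comparison[OF _ taylor_rem_LIMSEQ[OF t, of n B]]) (simp add: err[OF that])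
  qed
  have "(\<lambda>k. \<integral>\<eta>. g \<eta> * T k \<eta> \<partial>measure_pmf M) \<longlonglongrightarrow> (\<integral>\<eta>. g \<eta> * S t f \<eta> \<partial>measure_pmf M)"
    by (rule integral_pmf_tendsto[OF set_zr_pmf[OF zr] abs_le_on_mult[OF g T]])
       (use set_zr_pmf[OF zr] in \<open>auto intro!: tendsto_mult lim\<close>)
  moreover have "(\<integral>\<eta>. g \<eta> * T k \<eta> \<partial>measure_pmf M)
      = (\<Sum>i\<le>k. (\<integral>\<eta>. g \<eta> * (L ^^ i) f \<eta> \<partial>measure_pmf M) * (t ^ i / fact i))" for k
  proof -
    have i: "integrable (measure_pmf M) (\<lambda>\<eta>. g \<eta> * (L ^^ i) f \<eta>)" for i
      by (rule integrable_zr[OF zr abs_le_on_mult[OF g iterate_L(2)[OF f]]])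
    have "(\<integral>\<eta>. g \<eta> * T k \<eta> \<partial>measure_pmf M)
        = (\<integral>\<eta>. (\<Sum>i\<le>k. (g \<eta> * (L ^^ i) f \<eta>) * (t ^ i / fact i)) \<partial>measure_pmf M)"
      by (simp add: T_def sum_distrib_left mult.assoc)
    also have "\<dots> = (\<Sum>i\<le>k. \<integral>\<eta>. (g \<eta> * (L ^^ i) f \<eta>) * (t ^ i / fact i) \<partial>measure_pmf M)"
      by (intro Bochner_Integration.integral_sum integrable_mult_left i)
    finally show ?thesis by simp
  qed
  ultimately show ?thesis by simp
qed

section \<open>Symmetry, from local functions and short times to bounded functions and all
  times\<close>

lemma S_symmetric_local:
  assumes "depends_on n f" "abs_le_on configs f B" "depends_on m g" "abs_le_on configs g C"
    and "0 \<le> t" "t \<le> 1 / 4"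
  shows "(\<integral>\<eta>. g \<eta> * S t f \<eta> \<partial>measure_pmf M) = (\<integral>\<eta>. f \<eta> * S t g \<eta> \<partial>measure_pmf M)"
  using S_series[OF assms(1,2,4,5,6)] S_series[OF assms(3,4,2,5,6)] LIMSEQ_unique
  unfolding iterate_gen_symmetric[OF zr assms(1-4) p_q] by blast

text \<open>Both functions are truncated to local ones; dominated convergence is used twice, under
  the transition law and under \<open>M\<close>.\<close>

lemma S_symmetric_small:
  assumes f: "abs_le_on configs f B" and g: "abs_le_on configs g C" and t: "0 \<le> t" "t \<le> 1 / 4"
  shows "(\<integral>\<eta>. g \<eta> * S t f \<eta> \<partial>measure_pmf M) = (\<integral>\<eta>. f \<eta> * S t g \<eta> \<partial>measure_pmf M)"
proof -
  have lim: "(\<lambda>n. \<integral>\<eta>. h (trunc n \<eta>) * S t (\<lambda>\<eta>. k (trunc n \<eta>)) \<eta> \<partial>measure_pmf M)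
      \<longlonglongrightarrow> (\<integral>\<eta>. h \<eta> * S t k \<eta> \<partial>measure_pmf M)"
    if h: "abs_le_on configs h D" and k: "abs_le_on configs k D'" for h k D D'
  proof (rule integral_pmf_tendsto[OF set_zr_pmf[OF zr]])
    show "abs_le_on configs (\<lambda>\<eta>. h (trunc n \<eta>) * S t (\<lambda>\<eta>. k (trunc n \<eta>)) \<eta>) (D * D')" for n
      by (intro abs_le_on_mult abs_le_on_S abs_le_on_trunc h k t)
    fix \<eta> assume "\<eta> \<in> set_pmf M"
    then have \<eta>: "\<eta> \<in> configs" using set_zr_pmf[OF zr] by blast
    show "(\<lambda>n. h (trunc n \<eta>) * S t (\<lambda>\<eta>. k (trunc n \<eta>)) \<eta>) \<longlonglongrightarrow> h \<eta> * S t k \<eta>"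
      by (intro tendsto_mult trunc_LIMSEQ \<eta> S_tendsto[where f = "\<lambda>n \<xi>. k (trunc n \<xi>)" and g = k and B = D']
          t(1) abs_le_on_trunc[OF k])
  qed
  have "(\<integral>\<eta>. g (trunc n \<eta>) * S t (\<lambda>\<eta>. f (trunc n \<eta>)) \<eta> \<partial>measure_pmf M)
      = (\<integral>\<eta>. f (trunc n \<eta>) * S t (\<lambda>\<eta>. g (trunc n \<eta>)) \<eta> \<partial>measure_pmf M)" for n
    by (rule S_symmetric_local[OF depends_on_trunc abs_le_on_trunc[OF f] depends_on_trunc abs_le_on_trunc[OF g] t])
  then show ?thesis
    using lim[OF g f] lim[OF f g] LIMSEQ_unique by simp
qed

lemma S_symmetric:
  assumes f: "abs_le_on configs f B" and g: "abs_le_on configs g C" and t: "0 \<le> t"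
  shows "(\<integral>\<eta>. g \<eta> * S t f \<eta> \<partial>measure_pmf M) = (\<integral>\<eta>. f \<eta> * S t g \<eta> \<partial>measure_pmf M)"
proof -
  have *: "(\<integral>\<eta>. g \<eta> * S t f \<eta> \<partial>measure_pmf M) = (\<integral>\<eta>. f \<eta> * S t g \<eta> \<partial>measure_pmf M)"
    if "0 \<le> t" "t \<le> real k / 4" "abs_le_on configs f B" "abs_le_on configs g C" for k t f g
    using that
  proof (induction k arbitrary: t f g)
    case 0
    then show ?case using S_symmetric_small[OF 0(3,4)] by simp
  next
    case (Suc k)
    \<comment> \<open>A piece of length at most \<open>1 / 4\<close> is split off and the remainder
      is left to the induction hypothesis, which is general in the functions since the pieces are
      applied to images under the semigroup.\<close>
    define s where "s = min t (1 / 4)"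
    define r where "r = t - s"
    have sr: "0 \<le> s" "s \<le> 1 / 4" "0 \<le> r" "r \<le> real k / 4" "t = s + r" "t = r + s"
      using Suc.prems(1,2) by (auto simp: s_def r_def field_simps)
    have "(\<integral>\<eta>. g \<eta> * S t f \<eta> \<partial>measure_pmf M) = (\<integral>\<eta>. g \<eta> * S s (S r f) \<eta> \<partial>measure_pmf M)"
      unfolding sr(5) using set_zr_pmf[OF zr]
      by (intro integral_pmf_cong) (auto simp: S_semigroup[OF sr(1,3) _ Suc.prems(3)])
    also have "\<dots> = (\<integral>\<eta>. S r f \<eta> * S s g \<eta> \<partial>measure_pmf M)"
      by (rule S_symmetric_small[OF abs_le_on_S[OF sr(3) Suc.prems(3)] Suc.prems(4) sr(1,2)])
    also have "\<dots> = (\<integral>\<eta>. S s g \<eta> * S r f \<eta> \<partial>measure_pmf M)"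
      by (simp add: mult.commute)
    also have "\<dots> = (\<integral>\<eta>. f \<eta> * S r (S s g) \<eta> \<partial>measure_pmf M)"
      by (rule Suc.IH[OF sr(3,4) Suc.prems(3) abs_le_on_S[OF sr(1) Suc.prems(4)]])
    also have "\<dots> = (\<integral>\<eta>. f \<eta> * S t g \<eta> \<partial>measure_pmf M)"
      unfolding sr(6) using set_zr_pmf[OF zr]
      by (intro integral_pmf_cong) (auto simp: S_semigroup[OF sr(3,1) _ Suc.prems(4)])
    finally show ?case .
  qed
  obtain k :: nat where "4 * t \<le> real k" using real_arch_simple by blast
  then show ?thesis using *[OF t _ f g, of k] by simp
qed

sublocale reversible_process configs N P Z M
  by unfold_locales (use set_zr_pmf[OF zr] S_symmetric in blast)+

section \<open>Convergence to equilibrium\<close>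

text \<open>Every configuration arises from the vacuum by adding particles, each of which only
  rescales the weight. With mass 0 at the vacuum the total mass would be 0.\<close>

lemma pmf_vacuum_pos: "0 < pmf M vacuum"
proof (rule ccontr)
  assume "\<not> 0 < pmf M vacuum"
  then have v: "pmf M vacuum = 0" by (simp add: not_less)
  have "pmf M \<eta> = 0" if "\<eta> \<in> configs" for \<eta>
    using that by (induction rule: configs_induct) (auto simp: v pmf_add_at[OF zr] simp del: power_divide)
  then show False
    using set_pmf_not_empty[of M] set_zr_pmf[OF zr] by (auto simp: set_pmf_iff)
qed

lemma set_M_full:
  assumes "0 < p"
  shows "set_pmf M = configs"
proof -
  have r: "0 < p / q" using assms p_less_q by simp
  have "0 < pmf M \<eta>" if "\<eta> \<in> configs" for \<eta>
    using that
    by (induction rule: configs_induct)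
       (use r in \<open>auto simp: pmf_vacuum_pos pmf_add_at[OF zr] simp del: power_divide zero_less_divide_iff\<close>)
  then show ?thesis
    using set_zr_pmf[OF zr] by (auto simp: set_pmf_iff) (metis less_irrefl)
qed

lemma set_M_degenerate:
  assumes "p = 0"
  shows "set_pmf M = {vacuum}"
proof -
  have zero: "pmf M (add_at x \<eta>) = 0" if "\<eta> \<in> configs" "1 \<le> x" for x \<eta>
    using pmf_add_at[OF zr that] that(2) assms by simp
  have "\<eta> = vacuum \<or> pmf M \<eta> = 0" if "\<eta> \<in> configs" for \<eta>
    using that by (induction rule: configs_induct) (simp_all add: zero)
  then have "set_pmf M \<subseteq> {vacuum}"
    using set_zr_pmf[OF zr] by (auto simp: set_pmf_iff subset_iff)
  then show ?thesis
    using pmf_vacuum_pos by (auto simp: set_pmf_iff)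
qed

text \<open>Pairing \<open>g\<close> with \<open>L\<close> of its own truncations and letting the
  truncation tend to infinity shows that the Dirichlet form of \<open>g\<close> is 0. Every atom has
  positive mass, so all gradients vanish everywhere.\<close>

lemma harmonic_imp_const:
  assumes "0 < p" and g: "abs_le_on configs g C"
    and harm: "\<And>s \<eta>. 0 \<le> s \<Longrightarrow> \<eta> \<in> configs \<Longrightarrow> S s g \<eta> = g \<eta>" and "\<eta> \<in> configs"
  shows "g \<eta> = g vacuum"
proof -
  have r: "0 < p / q" "p / q < 1" using assms(1) p_less_q by auto
  \<comment> \<open>Harmonicity in weak form, with \<open>L\<close> acting on the local function
    only: by symmetry \<open>g\<close> is orthogonal to \<open>S h f - f\<close>, which is
    \<open>h * L f\<close> up to a uniform error \<open>e' * h\<close>.\<close>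
  have orth: "(\<integral>\<eta>. g \<eta> * L f \<eta> \<partial>measure_pmf M) = 0"
    if f: "depends_on n f" "abs_le_on configs f B" for n f B
  proof -
    let ?I = "\<integral>\<eta>. g \<eta> * L f \<eta> \<partial>measure_pmf M"
    note Lf = abs_le_on_L[OF f]
    have "\<bar>?I\<bar> \<le> 0 + e" if "0 < e" for e
    proof -
      have C: "0 \<le> C" by (rule abs_le_on_nonneg[OF g vacuum_configs])
      \<comment> \<open>Gives \<open>C * e' \<le> e\<close>; the summand 1 covers
        \<open>C = 0\<close>.\<close>
      define e' where "e' = e / (C + 1)"
      have e': "0 < e'" "C * e' \<le> e" using C \<open>0 < e\<close> by (auto simp: e'_def field_simps)
      obtain d where d: "0 < d" "\<And>h. 0 < h \<Longrightarrow> h < d \<Longrightarrow>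
          abs_le_on configs (\<lambda>\<eta>. S h f \<eta> - f \<eta> - h * L f \<eta>) (e' * h)"
        using S_gen_error[OF f e'(1)] by blast
      define h where "h = d / 2"
      have h: "0 < h" "h < d" using d(1) by (auto simp: h_def)
      let ?u = "\<lambda>\<eta>. S h f \<eta> - f \<eta> - h * L f \<eta>"
      have Shf: "abs_le_on configs (S h f) B" using h by (intro abs_le_on_S f) simp
      have "(\<integral>\<eta>. g \<eta> * S h f \<eta> \<partial>measure_pmf M) = (\<integral>\<eta>. f \<eta> * S h g \<eta> \<partial>measure_pmf M)"
        using h by (intro S_symmetric[OF f(2) g]) simp
      also have "\<dots> = (\<integral>\<eta>. g \<eta> * f \<eta> \<partial>measure_pmf M)"
        using supp harm h by (intro integral_pmf_cong) auto
      finally have "(\<integral>\<eta>. g \<eta> * ?u \<eta> \<partial>measure_pmf M) = - (h * ?I)"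
        using integrable_M[OF abs_le_on_mult[OF g Shf]] integrable_M[OF abs_le_on_mult[OF g f(2)]]
          integrable_M[OF abs_le_on_mult[OF g Lf]]
        by (simp add: right_diff_distrib mult.left_commute[of _ h])
      moreover have "\<bar>\<integral>\<eta>. g \<eta> * ?u \<eta> \<partial>measure_pmf M\<bar> \<le> C * (e' * h)"
      proof -
        have gu: "abs_le_on configs (\<lambda>\<eta>. g \<eta> * ?u \<eta>) (C * (e' * h))"
          by (intro abs_le_on_mult g d h)
        have "\<bar>\<integral>\<eta>. g \<eta> * ?u \<eta> \<partial>measure_pmf M\<bar> \<le> (\<integral>\<eta>. \<bar>g \<eta> * ?u \<eta>\<bar> \<partial>measure_pmf M)"
          by (rule integral_abs_bound)
        also have "\<dots> \<le> (\<integral>\<eta>. C * (e' * h) \<partial>measure_pmf M)"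
          using integrable_abs[OF integrable_M[OF gu]] abs_le_onD[OF gu] supp
          by (intro integral_mono_AE) (auto simp: AE_measure_pmf_iff)
        finally show ?thesis by simp
      qed
      ultimately have "h * \<bar>?I\<bar> \<le> h * (C * e')"
        using h(1) by (simp add: abs_mult mult_ac)
      then have "\<bar>?I\<bar> \<le> C * e'" using h(1) by simp
      then show ?thesis using e'(2) by simp
    qed
    then have "\<bar>?I\<bar> \<le> 0" by (rule field_le_epsilon)
    then show ?thesis by simp
  qed
  define w where "w x = p * (p / q) ^ x" for x
  \<comment> \<open>The contribution of edge \<open>x\<close> to the Dirichlet form of
    \<open>g\<close> and its truncation; \<open>D0\<close> is the corresponding term for
    \<open>g\<close> with itself.\<close>
  define D where "D n x = w x * (\<integral>\<eta>. grad g x \<eta> * grad (\<lambda>\<xi>. g (trunc n \<xi>)) x \<eta> \<partial>measure_pmf M)" for n x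
  define D0 where "D0 x = w x * (\<integral>\<eta>. (grad g x \<eta>)\<^sup>2 \<partial>measure_pmf M)" for x
  define K where "K = (C + C) * (C + C)"
  have w: "0 < w x" for x unfolding w_def using assms(1) r by (intro mult_pos_pos zero_less_power)
  have sw: "summable (\<lambda>x. K * w x)"
    unfolding w_def using r by (intro summable_mult summable_geometric) simp
  have grad: "abs_le_on configs (\<lambda>\<eta>. grad g x \<eta> * grad (\<lambda>\<xi>. g (trunc n \<xi>)) x \<eta>) K" for n x
    unfolding K_def by (intro abs_le_on_mult abs_le_on_grad abs_le_on_trunc g)
  have bound: "norm (D n x) \<le> K * w x" for n x
  proof -
    have "\<bar>\<integral>\<eta>. grad g x \<eta> * grad (\<lambda>\<xi>. g (trunc n \<xi>)) x \<eta> \<partial>measure_pmf M\<bar>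
        \<le> (\<integral>\<eta>. \<bar>grad g x \<eta> * grad (\<lambda>\<xi>. g (trunc n \<xi>)) x \<eta>\<bar> \<partial>measure_pmf M)"
      by (rule integral_abs_bound)
    also have "\<dots> \<le> (\<integral>\<eta>. K \<partial>measure_pmf M)"
      using integrable_abs[OF integrable_M[OF grad]] abs_le_onD[OF grad] supp
      by (intro integral_mono_AE) (auto simp: AE_measure_pmf_iff)
    finally show ?thesis
      using w[of x] by (simp add: D_def abs_mult mult.commute)
  qed
  have lim: "(\<lambda>n. D n x) \<longlonglongrightarrow> D0 x" for x
    unfolding D_def D0_def power2_eq_square
  proof (intro tendsto_mult tendsto_const integral_pmf_tendsto[OF supp grad])
    fix \<eta> assume "\<eta> \<in> set_pmf M"
    then have "\<eta> \<in> configs" using supp by blast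
    then show "(\<lambda>n. grad (\<lambda>\<xi>. g (trunc n \<xi>)) x \<eta>) \<longlonglongrightarrow> grad g x \<eta>"
      by (intro tendsto_diff trunc_LIMSEQ add_at_configs)
  qed
  \<comment> \<open>Once the sum covers all edges up to \<open>n\<close>, it is up to sign the
    pairing of \<open>g\<close> with \<open>L\<close> of the truncation, which is 0 by
    \<open>orth\<close>.\<close>
  have "(\<lambda>m. \<Sum>x<m. D n x) \<longlonglongrightarrow> 0" for n
  proof (rule tendsto_eventually, rule eventually_sequentiallyI[of "Suc n"])
    fix m assume "Suc n \<le> m"
    then obtain k where k: "m = Suc k" "n \<le> k" by (cases m) auto
    show "(\<Sum>x<m. D n x) = 0"
      using integral_gen[OF zr depends_on_trunc abs_le_on_trunc[OF g] g k(2)]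
        orth[OF depends_on_trunc abs_le_on_trunc[OF g], of n]
      unfolding D_def w_def k(1) lessThan_Suc_atMost by linarith
  qed
  then have suminf_D: "(\<Sum>x. D n x) = 0" for n
    by (metis sums_def sums_unique)
  \<comment> \<open>Tannery's theorem exchanges the limit in \<open>n\<close> with the sum over
    edges; the majorant \<open>K * w x\<close> is geometric because \<open>p < q\<close>.\<close>
  have tan: "summable D0 \<and> (\<lambda>n. suminf (D n)) \<longlonglongrightarrow> suminf D0"
  proof -
    have "\<forall>\<^sub>F (x, n) in at_top \<times>\<^sub>F sequentially. norm (D n x) \<le> K * w x"
      using bound by (intro always_eventually) auto
    from tannerys_theorem[where a = "\<lambda>x n. D n x", OF lim this sw sequentially_bot]
    show ?thesis using summable_norm_cancel[of D0] by blast
  qed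
  then have "suminf D0 = 0"
    by (simp add: suminf_D LIMSEQ_const_iff)
  moreover have nn: "0 \<le> D0 x" for x
    unfolding D0_def using w[of x] by (intro mult_nonneg_nonneg) auto
  ultimately have D0: "D0 x = 0" for x
    using tan suminf_eq_zero_iff[of D0] by auto
  have step: "g (add_at x \<xi>) = g (add_at (Suc x) \<xi>)" if \<xi>: "\<xi> \<in> configs" for x \<xi>
  proof -
    have i: "integrable (measure_pmf M) (\<lambda>\<eta>. (grad g x \<eta>)\<^sup>2)"
      using integrable_M[OF abs_le_on_mult[OF abs_le_on_grad[OF g] abs_le_on_grad[OF g]]]
      by (simp add: power2_eq_square)
    have "pmf M \<xi> * (grad g x \<xi>)\<^sup>2 \<le> (\<integral>\<eta>. (grad g x \<eta>)\<^sup>2 \<partial>measure_pmf M)"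
      using \<xi> set_M_full[OF assms(1)] by (intro pmf_mult_le_integral i) auto
    also have "\<dots> = 0" using D0[of x] w[of x] by (simp add: D0_def)
    finally have "(grad g x \<xi>)\<^sup>2 \<le> 0"
      using \<xi> set_M_full[OF assms(1)] pmf_positive[of \<xi> M] by (simp add: mult_le_0_iff)
    then show ?thesis by simp
  qed
  \<comment> \<open>The equalities \<open>step\<close> chain from site \<open>x\<close> down to site
    0, where \<open>add_at 0\<close> is the identity.\<close>
  have add: "g (add_at x \<xi>) = g \<xi>" if "\<xi> \<in> configs" for x \<xi>
    using step[OF that] by (induction x) (auto simp: add_at_def[of 0])
  show ?thesis
    using \<open>\<eta> \<in> configs\<close> by (induction rule: configs_induct) (simp_all add: add)
qed

lemma S_vacuum_tendsto:
  assumes f: "abs_le_on configs f B"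
  shows "((\<lambda>t. S t f vacuum) \<longlongrightarrow> (\<integral>\<eta>. f \<eta> \<partial>measure_pmf M)) at_top"
proof (cases "p = 0")
  case True
  \<comment> \<open>\<open>M\<close> is the point mass at the vacuum, so invariance already gives
    the exact value at every time.\<close>
  have eq: "(\<integral>\<eta>. h \<eta> \<partial>measure_pmf M) = h vacuum" for h :: "config \<Rightarrow> real"
    using integral_pmf_cong[of M h "\<lambda>_. h vacuum"] set_M_degenerate[OF True] by simp
  have "S t f vacuum = (\<integral>\<eta>. f \<eta> \<partial>measure_pmf M)" if "0 \<le> t" for t
    using S_invariant[OF that f] eq[of "S t f"] by simp
  then show ?thesis
    by (intro tendsto_eventually) (auto intro: eventually_at_top_linorderI[of 0])
next
  case False
  then have "0 < p" using p_nonneg by simp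
  obtain g where g: "abs_le_on configs g B" "\<And>x. x \<in> configs \<Longrightarrow> ((\<lambda>t. S t f x) \<longlongrightarrow> g x) at_top"
    "\<And>s x. 0 \<le> s \<Longrightarrow> x \<in> configs \<Longrightarrow> S s g x = g x"
    "(\<integral>x. g x \<partial>measure_pmf M) = (\<integral>x. f x \<partial>measure_pmf M)"
    using S_converges[OF set_M_full[OF \<open>0 < p\<close>] f] by blast
  have "(\<integral>x. f x \<partial>measure_pmf M) = (\<integral>x. g vacuum \<partial>measure_pmf M)"
    unfolding g(4)[symmetric]
    using supp harmonic_imp_const[OF \<open>0 < p\<close> g(1,3)] by (intro integral_pmf_cong) auto
  then show ?thesis using g(2)[OF vacuum_configs] by simp
qed

lemma cdf_num_particles_Z:
  assumes "0 \<le> t" "\<zeta> \<in> configs"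
  shows "cdf (distr (P \<zeta>) borel (\<lambda>\<omega>. num_particles (Z t \<omega>))) c
    = S t (\<lambda>\<eta>. of_bool (num_particles \<eta> \<le> c)) \<zeta>"
proof -
  have m: "(\<lambda>\<omega>. num_particles (Z t \<omega>)) \<in> borel_measurable (P \<zeta>)"
    by (rule measurable_obs[OF assms])
  have "cdf (distr (P \<zeta>) borel (\<lambda>\<omega>. num_particles (Z t \<omega>))) c
      = measure (P \<zeta>) ((\<lambda>\<omega>. num_particles (Z t \<omega>)) -` {..c} \<inter> space (P \<zeta>))"
    unfolding cdf_def by (intro measure_distr m) simp
  also have "\<dots> = (\<integral>\<omega>. indicator ((\<lambda>\<omega>. num_particles (Z t \<omega>)) -` {..c} \<inter> space (P \<zeta>)) \<omega> \<partial>P \<zeta>)"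
    by simp
  also have "\<dots> = S t (\<lambda>\<eta>. of_bool (num_particles \<eta> \<le> c)) \<zeta>"
    unfolding semigroup_of_def
    by (intro Bochner_Integration.integral_cong refl) (auto simp: indicator_def)
  finally show ?thesis .
qed

end

theorem proposition2p1:
  fixes p q :: real and N :: "'s measure" and P :: "config \<Rightarrow> 's measure"
    and Z :: "real \<Rightarrow> 's \<Rightarrow> config" and \<zeta> :: config
  assumes "0 \<le> p" and "0 \<le> q" and "p + q = 1" and "p < q"
    and "zero_range_process p q N P Z"
    and "\<zeta> \<in> configs" and "\<And>x. x \<ge> 1 \<Longrightarrow> \<zeta> x = 0"
  shows "\<forall>\<tau> :: nat \<Rightarrow> real. filterlim \<tau> at_top sequentially \<longrightarrow>
    weak_conv_m (\<lambda>n. distr (P \<zeta>) borel (\<lambda>\<omega>. num_particles (Z (\<tau> n) \<omega>)))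
                (distr (mu_ZR p q) borel num_particles)"
proof (intro allI impI)
  interpret subcritical_zrp p q N P Z
    using assms(1,3-5) by (simp add: subcritical_zrp_def subcritical_zrp_axioms_def)
  have \<zeta>: "\<zeta> = vacuum" by (rule eq_vacuumI[OF assms(6,7)])
  fix \<tau> :: "nat \<Rightarrow> real" assume \<tau>: "filterlim \<tau> at_top sequentially"
  show "weak_conv_m (\<lambda>n. distr (P \<zeta>) borel (\<lambda>\<omega>. num_particles (Z (\<tau> n) \<omega>)))
                (distr (mu_ZR p q) borel num_particles)"
    unfolding weak_conv_m_def weak_conv_def
  proof (intro allI impI)
    fix c
    \<comment> \<open>This indicator is bounded, so the convergence from the vacuum applies to it at
      any \<open>c\<close> and yields the distribution function there.\<close>
    let ?f = "\<lambda>\<eta>. of_bool (num_particles \<eta> \<le> c) :: real"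
    have "abs_le_on configs ?f 1" by (simp add: abs_le_on_def)
    from filterlim_compose[OF S_vacuum_tendsto[OF this] \<tau>]
    have "(\<lambda>n. S (\<tau> n) ?f \<zeta>) \<longlonglongrightarrow> cdf (distr (mu_ZR p q) borel num_particles) c"
      unfolding \<zeta> cdf_num_particles[OF zr] .
    \<comment> \<open>The law of \<open>Z (\<tau> n)\<close> is under control at nonnegative times
      only, and \<open>\<tau> n\<close> is eventually nonnegative.\<close>
    moreover have "\<forall>\<^sub>F n in sequentially.
        S (\<tau> n) ?f \<zeta> = cdf (distr (P \<zeta>) borel (\<lambda>\<omega>. num_particles (Z (\<tau> n) \<omega>))) c"
      using filterlim_at_top[THEN iffD1, OF \<tau>, rule_format, of 0]
      by eventually_elim (rule cdf_num_particles_Z[OF _ assms(6), symmetric])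
    ultimately show "(\<lambda>n. cdf (distr (P \<zeta>) borel (\<lambda>\<omega>. num_particles (Z (\<tau> n) \<omega>))) c)
        \<longlonglongrightarrow> cdf (distr (mu_ZR p q) borel num_particles) c"
      by (rule Lim_transform_eventually)
  qed
qed

end
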